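(* For each $n\ge 1$ let $(\xi_{n,i})_{1\le i\le n}$ be a (possibly non-homogeneous) Markov chain and let $X_{n,i}=f_{n,i}(\xi_{n,i})$, $1\le i\le n$, where the $f_{n,i}$ are real-valued measurable functions, with $\mathbf{E}X_{n,i}=0$ and $\mathbf{E}X_{n,i}^2<\infty$. Let $\lambda_n$, $\sigma_n$, $b_n$ be as in the context, and assume $\lambda_n b_n>0$ for all $n\ge 1$. Suppose that for some finite positive constants $C_n$, $$\max_{1\le i\le n}|X_{n,i}|\le C_n\quad\text{a.s.}$$ and $$\frac{C_n(1+|\ln(\lambda_n)|)}{\lambda_n\sigma_n}\to 0\quad\text{as } n\to\infty.$$ Then $$\frac{\sum_{i=1}^n X_{n,i}}{\sigma_n}\to N(0,1)\quad\text{in distribution as } n\to\infty.$$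
   Context: All Markov chains are defined on a probability space $(\Omega,\mathcal{K},\mathbf{P})$ and take values in a measurable space $(\mathcal{X},\mathcal{B}(\mathcal{X}))$. For sub-$\sigma$-algebras $\mathcal{A},\mathcal{B}$ of $\mathcal{K}$, the maximal coefficient of correlation is $$\rho(\mathcal{A},\mathcal{B})=\sup_{f\in \mathbf{L}_2(\mathcal{A}),\,g\in \mathbf{L}_2(\mathcal{B})}|\mathrm{corr}(f,g)|,$$ where $\mathbf{L}_2(\mathcal{A})$ is the space of square integrable $\mathcal{A}$-measurable random variables (the correlation is taken to be $0$ if one of the variables is a.s. constant). Define $\rho_{n,1}=\max_{1\le s\le n-1}\rho(\sigma(\xi_{n,s}),\sigma(\xi_{n,s+1}))$ (with $\rho_{1,1}=0$) and $\lambda_n=1-\rho_{n,1}$. Put $S_n=\sum_{i=1}^n X_{n,i}$, $\sigma_n^2=\mathrm{var}\,S_n$, $b_n^2=\sum_{i=1}^n \mathrm{var}\,X_{n,i}$, with $\sigma_n,b_n\ge 0$. The condition $\lambda_n b_n>0$ is equivalent to $\lambda_n\sigma_n>0$. $N(0,1)$ is the standard normal law. *)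

theory Defs
  imports "HOL-Probability.Probability"
begin

definition sigma_gen :: "'a measure \<Rightarrow> 'b measure \<Rightarrow> ('a \<Rightarrow> 'b) \<Rightarrow> 'a measure" where
  "sigma_gen M N \<xi> = vimage_algebra (space M) \<xi> N"

definition sigma_past :: "'a measure \<Rightarrow> 'b measure \<Rightarrow> (nat \<Rightarrow> 'a \<Rightarrow> 'b) \<Rightarrow> nat \<Rightarrow> 'a measure" where
  "sigma_past M N \<xi> i =
     vimage_algebra (space M) (\<lambda>\<omega>. \<lambda>j\<in>{1..i}. \<xi> j \<omega>) (\<Pi>\<^sub>M j\<in>{1..i}. N)"

text \<open>
  A finite chain \<open>\<xi> 1, \<dots>, \<xi> n\<close> with values in an arbitrary measurable space \<open>N\<close>; the Markov property
  is stated through conditional probabilities, so no transition kernels need to exist.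
\<close>

definition markov_chain :: "'a measure \<Rightarrow> 'b measure \<Rightarrow> nat \<Rightarrow> (nat \<Rightarrow> 'a \<Rightarrow> 'b) \<Rightarrow> bool" where
  "markov_chain M N n \<xi> \<longleftrightarrow>
     (\<forall>i\<in>{1..n}. \<xi> i \<in> measurable M N) \<and>
     (\<forall>i\<in>{1..<n}. \<forall>B\<in>sets N. AE \<omega> in M.
        real_cond_exp M (sigma_past M N \<xi> i) (\<lambda>\<omega>. indicator B (\<xi> (Suc i) \<omega>)) \<omega> =
        real_cond_exp M (sigma_gen M N (\<xi> i)) (\<lambda>\<omega>. indicator B (\<xi> (Suc i) \<omega>)) \<omega>)"

definition covariance :: "'a measure \<Rightarrow> ('a \<Rightarrow> real) \<Rightarrow> ('a \<Rightarrow> real) \<Rightarrow> real" where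
  "covariance M f g =
     prob_space.expectation M
       (\<lambda>\<omega>. (f \<omega> - prob_space.expectation M f) * (g \<omega> - prob_space.expectation M g))"

text \<open>
  If \<open>f\<close> or \<open>g\<close> is almost surely constant, then the denominator vanishes and the correlation is
  \<open>0\<close>, as division by zero yields zero.
\<close>

definition corr :: "'a measure \<Rightarrow> ('a \<Rightarrow> real) \<Rightarrow> ('a \<Rightarrow> real) \<Rightarrow> real" where
  "corr M f g =
     covariance M f g / (sqrt (prob_space.variance M f) * sqrt (prob_space.variance M g))"

text \<open>Sub-\<open>\<sigma>\<close>-algebras are represented by measures \<open>A\<close> with \<open>subalgebra M A\<close>; only \<open>sets A\<close> matters.\<close>

definition L2 :: "'a measure \<Rightarrow> 'a measure \<Rightarrow> ('a \<Rightarrow> real) set" where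
  "L2 M A = {f \<in> borel_measurable A. integrable M (\<lambda>\<omega>. (f \<omega>)\<^sup>2)}"

text \<open>
  The supremum is one of reals; on a probability space it is taken over a nonempty set
  bounded by \<open>1\<close> (Cauchy--Schwarz).
\<close>

definition max_corr :: "'a measure \<Rightarrow> 'a measure \<Rightarrow> 'a measure \<Rightarrow> real" where
  "max_corr M A B = (SUP (f, g)\<in>L2 M A \<times> L2 M B. \<bar>corr M f g\<bar>)"

definition chain_rho :: "'a measure \<Rightarrow> 'b measure \<Rightarrow> nat \<Rightarrow> (nat \<Rightarrow> 'a \<Rightarrow> 'b) \<Rightarrow> real" where
  "chain_rho M N n \<xi> =
     (if n \<le> 1 then 0
      else (MAX s\<in>{1..n - 1}. max_corr M (sigma_gen M N (\<xi> s)) (sigma_gen M N (\<xi> (Suc s)))))"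

definition chain_lambda :: "'a measure \<Rightarrow> 'b measure \<Rightarrow> nat \<Rightarrow> (nat \<Rightarrow> 'a \<Rightarrow> 'b) \<Rightarrow> real" where
  "chain_lambda M N n \<xi> = 1 - chain_rho M N n \<xi>"

definition row_sum :: "nat \<Rightarrow> (nat \<Rightarrow> 'a \<Rightarrow> real) \<Rightarrow> 'a \<Rightarrow> real" where
  "row_sum n X \<omega> = (\<Sum>i=1..n. X i \<omega>)"

definition sigma_sum :: "'a measure \<Rightarrow> nat \<Rightarrow> (nat \<Rightarrow> 'a \<Rightarrow> real) \<Rightarrow> real" where
  "sigma_sum M n X = sqrt (prob_space.variance M (row_sum n X))"

definition b_sum :: "'a measure \<Rightarrow> nat \<Rightarrow> (nat \<Rightarrow> 'a \<Rightarrow> real) \<Rightarrow> real" where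
  "b_sum M n X = sqrt (\<Sum>i=1..n. prob_space.variance M (X i))"

end

theory Submission
  imports Defs
begin

text \<open>
  Fix a row with sum \<open>S\<close> and variance \<open>v\<close>, and let \<open>E\<^sub>k\<close> be the conditional expectation given the past up to
  time \<open>k\<close>. With \<open>H\<^sub>k = E\<^sub>k (X\<^sub>k\<^sub>+\<^sub>1 + \<dots> + X\<^sub>n)\<close> the sum is a sum of martingale differences
  \<open>D\<^sub>k = X\<^sub>k\<^sub>+\<^sub>1 + H\<^sub>k\<^sub>+\<^sub>1 - H\<^sub>k\<close>. The contraction of mean zero functions by the factor \<open>1 - \<lambda>\<close> in
  \<open>L\<^sub>2\<close> gives \<open>b\<^sup>2 \<le> 4 v / \<lambda>\<close>. The remaining conditional variance \<open>Q\<^sub>k = E\<^sub>k (D\<^sub>k\<^sup>2 + \<dots>)\<close> is a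
  function of the present, and \<open>exp (\<i> s (X\<^sub>1 + \<dots> + X\<^sub>k + H\<^sub>k) - s\<^sup>2 Q\<^sub>k / 2)\<close> is a martingale up to errors of
  third order. It interpolates between \<open>exp (- s\<^sup>2 v / 2)\<close> and \<open>exp (\<i> s S)\<close>, so that the
  characteristic function of \<open>S\<close> is Gaussian up to the sums of \<open>E D\<^sub>k\<^sup>4\<close> and \<open>E (Q\<^sub>k\<^sub>+\<^sub>1 - Q\<^sub>k)\<^sup>2\<close>.
  Both are \<open>O((K C)\<^sup>2 v)\<close> for a window of length \<open>K \<approx> (1 + \<bar>ln \<lambda>\<bar>) / \<lambda>\<close>: the terms of \<open>H\<^sub>k\<close> inside
  the window are bounded by \<open>K C\<close>, and those outside are so small in \<open>L\<^sub>2\<close> and \<open>L\<^sub>4\<close> that they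
  compensate all powers of \<open>1 / \<lambda>\<close>.
\<close>

subsection \<open>Conditional expectations along a Markov filtration\<close>

text \<open>Maximal correlation contracts only in mean square, so it gives no uniform bound on the
  predicted future \<open>H k\<close>. Inside the window, counting terms and the sup bound of
  conditional expectation are enough; outside, mean square decay is used, and fourth moments come
  from interpolating it with the sup bound. Hence the logarithm: \<open>q ^ K\<close> must beat
  \<open>lam ^ 5\<close>, four powers being lost to \<open>\<Theta> ^ 4\<close> and one to the
  comparison of \<open>bsq\<close> with \<open>v\<close>. A second obstacle: the squared increments
  of \<open>Q\<close> must sum to order \<open>A * v\<close>, where \<open>A\<close> is the square
  of \<open>K * C\<close>, but their expansion contains \<open>2 * E (Q k * (D k)\<^sup>2)\<close>,
  whose sum has order \<open>v\<^sup>2\<close>. Splitting \<open>Q k\<close> into its mean and a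
  fluctuation, the mean part telescopes to \<open>(E (Q 0))\<^sup>2\<close>, up to fourth moments,
  and is cancelled by \<open>- E ((Q 0)\<^sup>2)\<close>. Having \<open>Q k\<close> itself in the
  exponent, not its mean, makes the terms up to second order vanish in expectation, and
  \<open>Q k \<ge> 0\<close> keeps the factor at most one.\<close>

lemma measurable_trivial_const:
  fixes f :: "'a \<Rightarrow> real"
  assumes "f \<in> borel_measurable S" "sets S = {{}, space S}"
  obtains c where "\<And>x. x \<in> space S \<Longrightarrow> f x = c"
proof (cases "space S = {}")
  case True
  then show ?thesis using that by auto
next
  case False
  then obtain y where y: "y \<in> space S" by blast
  have "f -` {f y} \<inter> space S \<in> sets S"
    by (intro measurable_sets[OF assms(1)]) auto
  with y assms(2) have "f -` {f y} \<inter> space S = space S"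
    by auto
  then show ?thesis
    using that[of "f y"] by blast
qed

section \<open>Essentially bounded variables, conditional expectation, Cauchy--Schwarz\<close>

context prob_space
begin

text \<open>The class is an algebra closed under conditional expectation, so integrability of every
  polynomial expression below is automatic.\<close>

definition ess_bounded :: "('a \<Rightarrow> real) \<Rightarrow> bool" where
  "ess_bounded f \<longleftrightarrow> f \<in> borel_measurable M \<and> (\<exists>B. AE x in M. \<bar>f x\<bar> \<le> B)"

lemma ess_boundedI:
  assumes "f \<in> borel_measurable M" "AE x in M. \<bar>f x\<bar> \<le> B"
  shows "ess_bounded f"
  using assms unfolding ess_bounded_def by blast

lemma ess_bounded_measurable [measurable_dest]: "ess_bounded f \<Longrightarrow> f \<in> borel_measurable M"
  unfolding ess_bounded_def by blast

lemma ess_bounded_integrable [simp]: "ess_bounded f \<Longrightarrow> integrable M f"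
  unfolding ess_bounded_def by (auto intro!: integrable_const_bound)

lemma ess_bounded_const [simp]: "ess_bounded (\<lambda>_. c)"
  unfolding ess_bounded_def by auto

lemma ess_bounded_add [simp]:
  assumes "ess_bounded f" "ess_bounded g"
  shows "ess_bounded (\<lambda>x. f x + g x)"
proof -
  obtain A B where *: "AE x in M. \<bar>f x\<bar> \<le> A" "AE x in M. \<bar>g x\<bar> \<le> B"
    using assms unfolding ess_bounded_def by blast
  have "AE x in M. \<bar>f x + g x\<bar> \<le> A + B"
    using * by eventually_elim linarith
  then show ?thesis
    using assms unfolding ess_bounded_def by auto
qed

lemma ess_bounded_mult [simp]:
  assumes "ess_bounded f" "ess_bounded g"
  shows "ess_bounded (\<lambda>x. f x * g x)"
proof -
  obtain A B where *: "AE x in M. \<bar>f x\<bar> \<le> A" "AE x in M. \<bar>g x\<bar> \<le> B"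
    using assms unfolding ess_bounded_def by blast
  have "AE x in M. \<bar>f x * g x\<bar> \<le> A * B"
    using * by eventually_elim (auto simp: abs_mult intro!: mult_mono)
  then show ?thesis
    using assms unfolding ess_bounded_def by auto
qed

lemma ess_bounded_uminus [simp]: "ess_bounded f \<Longrightarrow> ess_bounded (\<lambda>x. - f x)"
  using ess_bounded_mult[of "\<lambda>_. -1" f] by simp

lemma ess_bounded_diff [simp]:
  "ess_bounded f \<Longrightarrow> ess_bounded g \<Longrightarrow> ess_bounded (\<lambda>x. f x - g x)"
  using ess_bounded_add[of f "\<lambda>x. - g x"] by simp

lemma ess_bounded_power [simp]: "ess_bounded f \<Longrightarrow> ess_bounded (\<lambda>x. f x ^ m)"
  by (induction m) auto

lemma ess_bounded_abs [simp]: "ess_bounded f \<Longrightarrow> ess_bounded (\<lambda>x. \<bar>f x\<bar>)"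
  unfolding ess_bounded_def by auto

lemma ess_bounded_sum [simp]:
  "(\<And>i. i \<in> I \<Longrightarrow> ess_bounded (f i)) \<Longrightarrow> ess_bounded (\<lambda>x. \<Sum>i\<in>I. f i x)"
  by (induction I rule: infinite_finite_induct) auto

lemma ess_bounded_indicator [simp]: "A \<in> sets M \<Longrightarrow> ess_bounded (indicator A)"
  by (rule ess_boundedI[of _ 1]) (auto simp: indicator_def)

lemma ess_bounded_divide [simp]: "ess_bounded f \<Longrightarrow> ess_bounded (\<lambda>x. f x / c)"
  using ess_bounded_mult[of f "\<lambda>_. 1 / c"] by simp

lemma sigma_finite_subalg: "subalgebra M S \<Longrightarrow> sigma_finite_subalgebra M S"
  by (intro finite_measure_subalgebra_is_sigma_finite finite_measure_subalgebra.intro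
      finite_measure_subalgebra_axioms.intro finite_measure_axioms)

lemma cond_exp_abs_le:
  assumes "subalgebra M S" "integrable M f" "AE x in M. \<bar>f x\<bar> \<le> B"
  shows "AE x in M. \<bar>real_cond_exp M S f x\<bar> \<le> B"
proof -
  interpret S: sigma_finite_subalgebra M S by (rule sigma_finite_subalg) fact
  have "AE x in M. f x \<le> B" "AE x in M. f x \<ge> - B"
    using assms(3) by (eventually_elim, linarith)+
  then have "AE x in M. real_cond_exp M S f x \<le> B" "AE x in M. real_cond_exp M S f x \<ge> - B"
    using S.real_cond_exp_le_c[OF assms(2)] S.real_cond_exp_ge_c[OF assms(2)] by blast+
  then show ?thesis
    by eventually_elim auto
qed

lemma ess_bounded_cond_exp:
  assumes "subalgebra M S" "ess_bounded f"
  shows "ess_bounded (real_cond_exp M S f)"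
  using assms cond_exp_abs_le[OF assms(1) ess_bounded_integrable[OF assms(2)]]
  unfolding ess_bounded_def by (auto intro: borel_measurable_cond_exp2)

lemma expectation_cond_exp_mult:
  assumes "subalgebra M S" "ess_bounded f" "ess_bounded \<psi>" "\<psi> \<in> borel_measurable S"
  shows "expectation (\<lambda>x. real_cond_exp M S f x * \<psi> x) = expectation (\<lambda>x. f x * \<psi> x)"
proof -
  interpret S: sigma_finite_subalgebra M S by (rule sigma_finite_subalg) fact
  show ?thesis
    using S.real_cond_exp_intg(2)[of \<psi> f] assms
    by (simp add: mult.commute ess_bounded_measurable)
qed

lemma integrable_mult_L2:
  fixes f g :: "'a \<Rightarrow> real"
  assumes [measurable]: "f \<in> borel_measurable M" "g \<in> borel_measurable M"
    and i: "integrable M (\<lambda>x. (f x)\<^sup>2)" "integrable M (\<lambda>x. (g x)\<^sup>2)"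
  shows "integrable M (\<lambda>x. f x * g x)"
proof (rule Bochner_Integration.integrable_bound)
  show "integrable M (\<lambda>x. (f x)\<^sup>2 + (g x)\<^sup>2)"
    using i by simp
  have "\<bar>a * b\<bar> \<le> a\<^sup>2 + b\<^sup>2" for a b :: real
  proof -
    have "0 \<le> \<bar>a\<bar> * \<bar>b\<bar>" "2 * \<bar>a\<bar> * \<bar>b\<bar> \<le> a\<^sup>2 + b\<^sup>2"
      using sum_squares_bound[of "\<bar>a\<bar>" "\<bar>b\<bar>"] by auto
    then show ?thesis
      unfolding abs_mult by linarith
  qed
  then show "AE x in M. norm (f x * g x) \<le> norm ((f x)\<^sup>2 + (g x)\<^sup>2)"
    by (intro AE_I2) simp
qed simp

text \<open>Cauchy--Schwarz, from the discriminant of the nonnegative quadratic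
  \<open>E ((f - t * g)\<^sup>2)\<close> in \<open>t\<close>.\<close>

lemma expectation_mult_sq_le:
  fixes f g :: "'a \<Rightarrow> real"
  assumes m: "f \<in> borel_measurable M" "g \<in> borel_measurable M"
    and i: "integrable M (\<lambda>x. (f x)\<^sup>2)" "integrable M (\<lambda>x. (g x)\<^sup>2)"
  shows "(expectation (\<lambda>x. f x * g x))\<^sup>2 \<le> expectation (\<lambda>x. (f x)\<^sup>2) * expectation (\<lambda>x. (g x)\<^sup>2)"
proof -
  define a b c where "a = expectation (\<lambda>x. (f x)\<^sup>2)" and "b = expectation (\<lambda>x. f x * g x)"
    and "c = expectation (\<lambda>x. (g x)\<^sup>2)"
  have quad: "0 \<le> a - 2 * t * b + t\<^sup>2 * c" for t
  proof -
    have "0 \<le> expectation (\<lambda>x. (f x - t * g x)\<^sup>2)"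
      by simp
    also have "(\<lambda>x. (f x - t * g x)\<^sup>2) = (\<lambda>x. (f x)\<^sup>2 - 2 * t * (f x * g x) + t\<^sup>2 * (g x)\<^sup>2)"
      by (auto simp: power2_eq_square algebra_simps)
    also have "expectation \<dots> = a - 2 * t * b + t\<^sup>2 * c"
      unfolding a_def b_def c_def using i integrable_mult_L2[OF m i] by simp
    finally show ?thesis .
  qed
  show ?thesis
  proof (cases "c = 0")
    case True
    have "b = 0"
    proof (rule ccontr)
      assume "b \<noteq> 0"
      then show False
        \<comment> \<open>At this \<open>t\<close> the remaining linear function
          \<open>a - 2 * t * b\<close> equals \<open>-1\<close>.\<close>
        using quad[of "(a + 1) / (2 * b)"] True by (simp add: field_simps)
    qed
    then show ?thesis
      using True by (simp add: a_def b_def c_def)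
  next
    case False
    then have "c > 0"
      unfolding c_def by (simp add: order_less_le)
    then have "0 \<le> (a * c - b\<^sup>2) / c"
      using quad[of "b / c"] by (simp add: field_simps power2_eq_square)
    then show ?thesis
      using \<open>c > 0\<close> by (simp add: zero_le_divide_iff a_def b_def c_def)
  qed
qed

end

text \<open>What the analysis needs from a chain: \<open>F k\<close> is the past and
  \<open>G k\<close> the present at time \<open>k\<close>. All \<open>k\<close> are allowed, so that
  no boundary cases arise later; a finite chain is padded with trivial sigma-algebras.\<close>

locale mixing_filtration = prob_space M for M :: "'a measure" +
  fixes F G :: "nat \<Rightarrow> 'a measure" and lam :: real
  assumes subalg_F: "\<And>k. subalgebra M (F k)"
    and subalg_G: "\<And>k. subalgebra (F k) (G k)"
    and F_mono: "\<And>k. subalgebra (F (Suc k)) (F k)"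
    and F_0: "sets (F 0) = {{}, space M}"
    and markov: "\<And>k f. f \<in> borel_measurable (G (Suc k)) \<Longrightarrow> ess_bounded f \<Longrightarrow>
      AE x in M. real_cond_exp M (F k) f x = real_cond_exp M (G k) f x"
    and contraction: "\<And>k f. f \<in> borel_measurable (G (Suc k)) \<Longrightarrow> ess_bounded f \<Longrightarrow>
      expectation f = 0 \<Longrightarrow>
      expectation (\<lambda>x. (real_cond_exp M (G k) f x)\<^sup>2) \<le> (1 - lam)\<^sup>2 * expectation (\<lambda>x. (f x)\<^sup>2)"
    and lam_pos: "0 < lam" and lam_le: "lam \<le> 1"
begin

definition proj :: "nat \<Rightarrow> ('a \<Rightarrow> real) \<Rightarrow> 'a \<Rightarrow> real" where
  "proj k f = real_cond_exp M (G k) f"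

lemma subalg_MG: "subalgebra M (G k)"
  using subalg_F[of k] subalg_G[of k] by (auto simp: subalgebra_def)

lemma F_le: "k \<le> j \<Longrightarrow> subalgebra (F j) (F k)"
proof (induction j rule: dec_induct)
  case (step j)
  then show ?case using F_mono[of j] by (auto simp: subalgebra_def)
qed (auto simp: subalgebra_def)

lemma measurable_F_le: "f \<in> measurable (F k) N \<Longrightarrow> k \<le> j \<Longrightarrow> f \<in> measurable (F j) N"
  using F_le measurable_from_subalg by blast

lemma measurable_GF: "f \<in> measurable (G k) N \<Longrightarrow> k \<le> j \<Longrightarrow> f \<in> measurable (F j) N"
  using measurable_F_le subalg_G measurable_from_subalg by blast

lemma measurable_FM: "f \<in> measurable (F k) N \<Longrightarrow> f \<in> measurable M N"
  using subalg_F measurable_from_subalg by blast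

lemma proj_measurable [measurable]: "proj k f \<in> borel_measurable (G k)"
  unfolding proj_def by simp

lemma proj_measurable_M [measurable]: "proj k f \<in> borel_measurable M"
  unfolding proj_def by simp

lemma ess_bounded_proj [simp]: "ess_bounded f \<Longrightarrow> ess_bounded (proj k f)"
  unfolding proj_def by (rule ess_bounded_cond_exp[OF subalg_MG])

lemma proj_abs_le:
  "ess_bounded f \<Longrightarrow> AE x in M. \<bar>f x\<bar> \<le> B \<Longrightarrow> AE x in M. \<bar>proj k f x\<bar> \<le> B"
  unfolding proj_def by (rule cond_exp_abs_le[OF subalg_MG]) auto

lemma expectation_proj [simp]: "ess_bounded f \<Longrightarrow> expectation (proj k f) = expectation f"
  using expectation_cond_exp_mult[OF subalg_MG, of f "\<lambda>_. 1" k] by (simp add: proj_def)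

lemma proj_AE_self:
  assumes "f \<in> borel_measurable (G k)" "ess_bounded f"
  shows "AE x in M. proj k f x = f x"
proof -
  interpret S: sigma_finite_subalgebra M "G k" by (rule sigma_finite_subalg[OF subalg_MG])
  show ?thesis unfolding proj_def using assms by auto
qed

text \<open>Here \<open>markov\<close> enters: conditioning on the present may be tested against a
  variable \<open>\<psi>\<close> of the whole past.\<close>

lemma expectation_proj_mult_Suc:
  assumes f: "f \<in> borel_measurable (G (Suc k))" "ess_bounded f"
    and p: "\<psi> \<in> borel_measurable (F k)" "ess_bounded \<psi>"
  shows "expectation (\<lambda>x. proj k f x * \<psi> x) = expectation (\<lambda>x. f x * \<psi> x)"
proof -
  have "expectation (\<lambda>x. proj k f x * \<psi> x) = expectation (\<lambda>x. real_cond_exp M (F k) f x * \<psi> x)"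
    using markov[OF f] p(2) unfolding proj_def
    by (intro integral_cong_AE) (auto simp: ess_bounded_measurable)
  also have "\<dots> = expectation (\<lambda>x. f x * \<psi> x)"
    by (rule expectation_cond_exp_mult[OF subalg_F f(2) p(2,1)])
  finally show ?thesis .
qed

text \<open>The sigma-algebras \<open>G k\<close> are not nested, so this is not the usual tower
  property. It holds because a set of \<open>G k\<close> lies in \<open>F j\<close>, where the
  Markov property applies.\<close>

lemma proj_tower:
  assumes f: "f \<in> borel_measurable (G (Suc j))" "ess_bounded f" and "k \<le> j"
  shows "AE x in M. proj k f x = proj k (proj j f) x"
proof -
  interpret S: sigma_finite_subalgebra M "G k" by (rule sigma_finite_subalg[OF subalg_MG])
  show ?thesis
    unfolding proj_def[of k f]
  proof (rule S.real_cond_exp_charact)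
    fix A assume A: "A \<in> sets (G k)"
    then have AF: "A \<in> sets (F j)" and AM: "A \<in> sets M"
      using subalg_G[of k] F_le[OF \<open>k \<le> j\<close>] subalg_MG[of k] by (auto simp: subalgebra_def)
    have "(\<integral>x\<in>A. f x \<partial>M) = expectation (\<lambda>x. f x * indicator A x)"
      by (simp add: set_lebesgue_integral_def mult.commute)
    also have "\<dots> = expectation (\<lambda>x. proj j f x * indicator A x)"
      using AF AM by (intro expectation_proj_mult_Suc[symmetric] f) auto
    also have "\<dots> = expectation (\<lambda>x. proj k (proj j f) x * indicator A x)"
      unfolding proj_def[of k] using A AM f
      by (intro expectation_cond_exp_mult[symmetric] subalg_MG) auto
    finally show "(\<integral>x\<in>A. f x \<partial>M) = (\<integral>x\<in>A. proj k (proj j f) x \<partial>M)"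
      by (simp add: set_lebesgue_integral_def mult.commute)
  qed (use f in auto)
qed

text \<open>The Markov property over several steps: \<open>proj_tower\<close> peels off one step at
  a time.\<close>

lemma expectation_proj_mult:
  assumes f: "f \<in> borel_measurable (G j)" "ess_bounded f" and "k \<le> j"
    and p: "\<psi> \<in> borel_measurable (F k)" "ess_bounded \<psi>"
  shows "expectation (\<lambda>x. proj k f x * \<psi> x) = expectation (\<lambda>x. f x * \<psi> x)"
  using \<open>k \<le> j\<close> f
proof (induction j arbitrary: f rule: dec_induct)
  case base
  then show ?case
    using proj_AE_self[of f k] p by (intro integral_cong_AE) (auto simp: ess_bounded_measurable)
next
  case (step j)
  have "expectation (\<lambda>x. proj k f x * \<psi> x) = expectation (\<lambda>x. proj k (proj j f) x * \<psi> x)"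
    using proj_tower[of f j k] step p by (intro integral_cong_AE) (auto simp: ess_bounded_measurable)
  also have "\<dots> = expectation (\<lambda>x. proj j f x * \<psi> x)"
    using step by auto
  also have "\<dots> = expectation (\<lambda>x. f x * \<psi> x)"
    using step p measurable_F_le by (intro expectation_proj_mult_Suc) auto
  finally show ?case .
qed

text \<open>Projections preserve mean zero, so the one-step contraction can be iterated along
  \<open>proj_tower\<close>.\<close>

lemma proj_contraction:
  assumes f: "f \<in> borel_measurable (G j)" "ess_bounded f" "expectation f = 0" and "k \<le> j"
  shows "expectation (\<lambda>x. (proj k f x)\<^sup>2) \<le> (1 - lam) ^ (2 * (j - k)) * expectation (\<lambda>x. (f x)\<^sup>2)"
  using \<open>k \<le> j\<close> f
proof (induction j arbitrary: f rule: dec_induct)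
  case base
  have "expectation (\<lambda>x. (proj k f x)\<^sup>2) = expectation (\<lambda>x. (f x)\<^sup>2)"
    using proj_AE_self[of f k] base by (intro integral_cong_AE) (auto simp: ess_bounded_measurable)
  then show ?case by simp
next
  case (step j)
  have "expectation (\<lambda>x. (proj k f x)\<^sup>2) = expectation (\<lambda>x. (proj k (proj j f) x)\<^sup>2)"
    using proj_tower[of f j k] step by (intro integral_cong_AE) (auto simp: ess_bounded_measurable)
  also have "\<dots> \<le> (1 - lam) ^ (2 * (j - k)) * expectation (\<lambda>x. (proj j f x)\<^sup>2)"
    using step by auto
  also have "\<dots> \<le> (1 - lam) ^ (2 * (j - k)) * ((1 - lam)\<^sup>2 * expectation (\<lambda>x. (f x)\<^sup>2))"
    using step lam_le unfolding proj_def by (intro mult_left_mono contraction) auto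
  also have "\<dots> = (1 - lam) ^ (2 * (Suc j - k)) * expectation (\<lambda>x. (f x)\<^sup>2)"
    using step(1) by (simp add: Suc_diff_le power_add power2_eq_square)
  finally show ?case .
qed

end

subsection \<open>Sums of projections\<close>

lemma square_add_le: "(a + b)\<^sup>2 \<le> 2 * a\<^sup>2 + 2 * b\<^sup>2" for a b :: real
  using zero_le_power2[of "a - b"] by (simp add: power2_eq_square algebra_simps)

lemma square_diff_le: "(a - b)\<^sup>2 \<le> 2 * a\<^sup>2 + 2 * b\<^sup>2" for a b :: real
  using square_add_le[of a "- b"] by simp

lemma fourth_power_add_le: "(a + b) ^ 4 \<le> 8 * a ^ 4 + 8 * b ^ 4" for a b :: real
proof -
  have "(a + b) ^ 4 = ((a + b)\<^sup>2)\<^sup>2" by simp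
  also have "\<dots> \<le> (2 * a\<^sup>2 + 2 * b\<^sup>2)\<^sup>2"
    by (intro power_mono square_add_le) auto
  also have "\<dots> \<le> 2 * (2 * a\<^sup>2)\<^sup>2 + 2 * (2 * b\<^sup>2)\<^sup>2"
    by (rule square_add_le)
  finally show ?thesis by (simp add: power_mult_distrib)
qed

lemma fourth_power_diff_le: "(a - b) ^ 4 \<le> 8 * a ^ 4 + 8 * b ^ 4" for a b :: real
  using fourth_power_add_le[of a "- b"] by simp

text \<open>AM--GM with a scale; the scale used later is \<open>K * C\<close>, at which second and
  fourth moments balance.\<close>

lemma abs_mult_le_weighted: "\<bar>a * b\<bar> \<le> (\<kappa> * a\<^sup>2 + b\<^sup>2 / \<kappa>) / 2" if "0 < \<kappa>" for a b \<kappa> :: real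
proof -
  have "0 \<le> (\<kappa> * \<bar>a\<bar> - \<bar>b\<bar>)\<^sup>2"
    by simp
  then have "2 * (\<bar>a\<bar> * \<bar>b\<bar>) * \<kappa> \<le> (\<kappa> * a\<^sup>2) * \<kappa> + b\<^sup>2"
    by (simp add: power2_eq_square algebra_simps)
  then show ?thesis
    using that by (simp add: abs_mult field_simps)
qed

lemma weighted_sum_square_le:
  fixes h w :: "'i \<Rightarrow> real"
  assumes "\<And>j. j \<in> J \<Longrightarrow> w j > 0"
  shows "(\<Sum>j\<in>J. h j)\<^sup>2 \<le> (\<Sum>j\<in>J. w j) * (\<Sum>j\<in>J. (h j)\<^sup>2 / w j)"
proof -
  have "(\<Sum>j\<in>J. h j) = (\<Sum>j\<in>J. sqrt (w j) * (h j / sqrt (w j)))"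
  proof (rule sum.cong)
    fix j assume "j \<in> J"
    then have "sqrt (w j) \<noteq> 0"
      using assms by force
    then show "h j = sqrt (w j) * (h j / sqrt (w j))"
      by simp
  qed simp
  also have "\<dots>\<^sup>2 \<le> (\<Sum>j\<in>J. (sqrt (w j))\<^sup>2) * (\<Sum>j\<in>J. (h j / sqrt (w j))\<^sup>2)"
    by (rule Cauchy_Schwarz_ineq_sum)
  also have "\<dots> = (\<Sum>j\<in>J. w j) * (\<Sum>j\<in>J. (h j)\<^sup>2 / w j)"
    using assms by (intro arg_cong2[where f = "(*)"] sum.cong) (auto simp: power_divide less_imp_le)
  finally show ?thesis .
qed

text \<open>The square inequality is used twice, for \<open>h\<close> and then for
  \<open>h\<^sup>2 / w\<close>; this is why the weights enter with third power.\<close>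

lemma weighted_sum_fourth_power_le:
  fixes h w :: "'i \<Rightarrow> real"
  assumes w: "\<And>j. j \<in> J \<Longrightarrow> w j > 0"
  shows "(\<Sum>j\<in>J. h j) ^ 4 \<le> (\<Sum>j\<in>J. w j) ^ 3 * (\<Sum>j\<in>J. (h j) ^ 4 / (w j) ^ 3)"
proof -
  have "(\<Sum>j\<in>J. h j) ^ 4 = ((\<Sum>j\<in>J. h j)\<^sup>2)\<^sup>2"
    by simp
  also have "\<dots> \<le> ((\<Sum>j\<in>J. w j) * (\<Sum>j\<in>J. (h j)\<^sup>2 / w j))\<^sup>2"
    by (intro power_mono weighted_sum_square_le w) auto
  also have "\<dots> = (\<Sum>j\<in>J. w j)\<^sup>2 * (\<Sum>j\<in>J. (h j)\<^sup>2 / w j)\<^sup>2"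
    by (simp add: power_mult_distrib)
  also have "\<dots> \<le> (\<Sum>j\<in>J. w j)\<^sup>2 * ((\<Sum>j\<in>J. w j) * (\<Sum>j\<in>J. ((h j)\<^sup>2 / w j)\<^sup>2 / w j))"
    by (intro mult_left_mono weighted_sum_square_le w) auto
  also have "\<dots> = (\<Sum>j\<in>J. w j) ^ 3 * (\<Sum>j\<in>J. (h j) ^ 4 / (w j) ^ 3)"
    by (simp add: power_divide power2_eq_square power3_eq_cube power4_eq_xxxx mult_ac)
  finally show ?thesis .
qed

section \<open>Geometric weights and moments of sums of projections\<close>

context mixing_filtration
begin

text \<open>
  \<open>q\<^sup>2 = exp (- lam)\<close> dominates the contraction factor \<open>1 - lam\<close> and stays positive when that
  factor vanishes; its powers serve as weights in the Cauchy--Schwarz inequality.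
\<close>

definition q :: real where "q = exp (- lam / 2)"

text \<open>The geometric series in \<open>q\<close>; it takes the role of \<open>1 / lam\<close>,
  to which \<open>Theta_le\<close> compares it.\<close>

definition \<Theta> :: real where "\<Theta> = 1 / (1 - q)"

lemma q_pos: "0 < q" and q_less: "q < 1"
  using lam_pos by (auto simp: q_def)

lemma Theta_ge: "1 \<le> \<Theta>"
  using q_pos q_less by (simp add: \<Theta>_def)

text \<open>This fixes the exponent in \<open>q\<close>: of the four powers, three pay for the cubed
  weight in the fourth moment bound, and one is left to be summed over the times.\<close>

lemma contraction_le_q: "(1 - lam)\<^sup>2 \<le> q ^ 4"
proof -
  have "1 - lam \<le> exp (- lam)"
    using exp_ge_add_one_self[of "- lam"] by simp
  also have "\<dots> = q\<^sup>2"
    by (simp add: q_def flip: exp_double)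
  finally have "(1 - lam)\<^sup>2 \<le> (q\<^sup>2)\<^sup>2"
    using lam_le by (intro power_mono) auto
  then show ?thesis by simp
qed

lemma sum_q_power_le:
  assumes "finite I" "\<And>i. i \<in> I \<Longrightarrow> K \<le> i"
  shows "(\<Sum>i\<in>I. q ^ i) \<le> q ^ K * \<Theta>"
proof -
  obtain m0 where m0: "\<And>i. i \<in> I \<Longrightarrow> i < m0"
    using \<open>finite I\<close> by (auto simp: finite_nat_set_iff_bounded)
  define m where "m = max K m0"
  have "K \<le> m"
    by (simp add: m_def)
  have m: "I \<subseteq> {K..<m}"
  proof
    fix i assume "i \<in> I"
    then show "i \<in> {K..<m}"
      using assms(2)[of i] m0[of i] by (simp add: m_def)
  qed
  have "(1 - q) * (\<Sum>i\<in>{K..<m}. q ^ i) = q ^ K - q ^ m"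
    using \<open>K \<le> m\<close>
  proof (induction m rule: dec_induct)
    case (step m)
    then show ?case
      by (simp add: distrib_left) (simp add: left_diff_distrib)
  qed simp
  then have "(1 - q) * (\<Sum>i\<in>{K..<m}. q ^ i) \<le> q ^ K"
    using q_pos by simp
  then have "(\<Sum>i\<in>{K..<m}. q ^ i) \<le> q ^ K * \<Theta>"
    using q_less by (simp add: \<Theta>_def pos_le_divide_eq mult.commute)
  moreover have "(\<Sum>i\<in>I. q ^ i) \<le> (\<Sum>i\<in>{K..<m}. q ^ i)"
    using m q_pos by (intro sum_mono2) auto
  ultimately show ?thesis by simp
qed

lemma sum_q_power_diff_le:
  assumes "finite J" "\<And>j. j \<in> J \<Longrightarrow> k + K \<le> j"
  shows "(\<Sum>j\<in>J. q ^ (j - k)) \<le> q ^ K * \<Theta>"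
proof -
  have "inj_on (\<lambda>j. j - k) J"
    using assms(2) by (intro inj_onI) (metis add_leD1 eq_diff_iff)
  then have "(\<Sum>j\<in>J. q ^ (j - k)) = (\<Sum>i\<in>(\<lambda>j. j - k) ` J. q ^ i)"
    by (simp add: sum.reindex)
  also have "\<dots> \<le> q ^ K * \<Theta>"
    using assms by (intro sum_q_power_le) force+
  finally show ?thesis .
qed

text \<open>After exchanging the sums, each \<open>y j\<close> is charged with one geometric tail
  over the lags \<open>j - k\<close>, so no factor \<open>n\<close> appears.\<close>

lemma double_sum_q_power_le:
  assumes "\<And>j. 0 \<le> y j"
  shows "(\<Sum>k\<le>n. \<Sum>j\<in>{k + K<..n}. q ^ (j - k) * y j) \<le> q ^ K * \<Theta> * (\<Sum>j\<in>{1..n}. y j)"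
proof -
  have "(\<Sum>k\<le>n. \<Sum>j\<in>{k + K<..n}. q ^ (j - k) * y j)
      = (\<Sum>k\<in>{..n}. \<Sum>j\<in>{j \<in> {1..n}. k + K < j}. q ^ (j - k) * y j)"
    by (intro sum.cong) auto
  also have "\<dots> = (\<Sum>j\<in>{1..n}. \<Sum>k\<in>{k \<in> {..n}. k + K < j}. q ^ (j - k) * y j)"
    by (rule sum.swap_restrict) auto
  also have "\<dots> \<le> (\<Sum>j\<in>{1..n}. q ^ K * \<Theta> * y j)"
  proof (rule sum_mono)
    fix j
    let ?I = "{k \<in> {..n}. k + K < j}"
    have "inj_on (\<lambda>k. j - k) ?I"
      by (rule inj_onI) auto
    then have "(\<Sum>k\<in>?I. q ^ (j - k)) = (\<Sum>i\<in>(\<lambda>k. j - k) ` ?I. q ^ i)"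
      by (simp add: sum.reindex)
    also have "\<dots> \<le> q ^ K * \<Theta>"
      by (intro sum_q_power_le) auto
    finally show "(\<Sum>k\<in>?I. q ^ (j - k) * y j) \<le> q ^ K * \<Theta> * y j"
      using assms by (simp add: mult_right_mono flip: sum_distrib_right)
  qed
  finally show ?thesis
    by (simp add: sum_distrib_left)
qed

lemma proj_contraction_q:
  assumes "f \<in> borel_measurable (G j)" "ess_bounded f" "expectation f = 0" "k \<le> j"
  shows "expectation (\<lambda>x. (proj k f x)\<^sup>2) \<le> q ^ (4 * (j - k)) * expectation (\<lambda>x. (f x)\<^sup>2)"
proof -
  have "(1 - lam) ^ (2 * (j - k)) \<le> q ^ (4 * (j - k))"
    using contraction_le_q by (simp add: power_mult power_mono)
  then have "(1 - lam) ^ (2 * (j - k)) * expectation (\<lambda>x. (f x)\<^sup>2)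
      \<le> q ^ (4 * (j - k)) * expectation (\<lambda>x. (f x)\<^sup>2)"
    by (intro mult_right_mono) auto
  with proj_contraction[OF assms] show ?thesis by linarith
qed

text \<open>Weights \<open>q ^ (j - k)\<close> turn the square of the sum into a sum of squares at
  the price \<open>\<Theta>\<close>. One power of \<open>q\<close> pays for the weight in the
  denominator, one remains in the bound.\<close>

lemma sum_proj_square_le:
  assumes J: "finite J" "\<And>j. j \<in> J \<Longrightarrow> k \<le> j"
    and g: "\<And>j. j \<in> J \<Longrightarrow> g j \<in> borel_measurable (G j)" "\<And>j. j \<in> J \<Longrightarrow> ess_bounded (g j)"
      "\<And>j. j \<in> J \<Longrightarrow> expectation (g j) = 0"
  shows "expectation (\<lambda>x. (\<Sum>j\<in>J. proj k (g j) x)\<^sup>2)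
    \<le> \<Theta> * (\<Sum>j\<in>J. q ^ (j - k) * expectation (\<lambda>x. (g j x)\<^sup>2))"
proof -
  have w: "(\<Sum>j\<in>J. q ^ (j - k)) \<le> \<Theta>"
    using sum_q_power_diff_le[of J k 0] J by simp
  have "expectation (\<lambda>x. (\<Sum>j\<in>J. proj k (g j) x)\<^sup>2)
      \<le> expectation (\<lambda>x. (\<Sum>j\<in>J. q ^ (j - k)) * (\<Sum>j\<in>J. (proj k (g j) x)\<^sup>2 / q ^ (j - k)))"
    using g q_pos by (intro integral_mono weighted_sum_square_le) auto
  also have "\<dots> = (\<Sum>j\<in>J. q ^ (j - k)) * (\<Sum>j\<in>J. expectation (\<lambda>x. (proj k (g j) x)\<^sup>2) / q ^ (j - k))"
    using g by (simp add: Bochner_Integration.integral_sum)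
  also have "\<dots> \<le> \<Theta> * (\<Sum>j\<in>J. q ^ (j - k) * expectation (\<lambda>x. (g j x)\<^sup>2))"
  proof (intro mult_mono w sum_mono)
    fix j assume j: "j \<in> J"
    have "expectation (\<lambda>x. (proj k (g j) x)\<^sup>2) \<le> q ^ (4 * (j - k)) * expectation (\<lambda>x. (g j x)\<^sup>2)"
      using j J g by (intro proj_contraction_q) auto
    also have "\<dots> \<le> q ^ (2 * (j - k)) * expectation (\<lambda>x. (g j x)\<^sup>2)"
      using q_pos q_less by (intro mult_right_mono power_decreasing) auto
    also have "\<dots> = q ^ (j - k) * expectation (\<lambda>x. (g j x)\<^sup>2) * q ^ (j - k)"
      by (simp add: mult_2 power_add)
    finally show "expectation (\<lambda>x. (proj k (g j) x)\<^sup>2) / q ^ (j - k)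
        \<le> q ^ (j - k) * expectation (\<lambda>x. (g j x)\<^sup>2)"
      using q_pos by (simp add: pos_divide_le_eq)
  qed (use q_pos q_less Theta_ge in \<open>auto intro!: sum_nonneg\<close>)
  finally show ?thesis .
qed

text \<open>Contraction is known in mean square only. One square of each projection is therefore
  bounded by \<open>B\<^sup>2\<close>, and the other one is contracted.\<close>

lemma sum_proj_fourth_power_le:
  assumes J: "finite J" "\<And>j. j \<in> J \<Longrightarrow> k \<le> j"
    and g: "\<And>j. j \<in> J \<Longrightarrow> g j \<in> borel_measurable (G j)" "\<And>j. j \<in> J \<Longrightarrow> ess_bounded (g j)"
      "\<And>j. j \<in> J \<Longrightarrow> expectation (g j) = 0"
    and B: "\<And>j. j \<in> J \<Longrightarrow> AE x in M. \<bar>g j x\<bar> \<le> B"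
  shows "expectation (\<lambda>x. (\<Sum>j\<in>J. proj k (g j) x) ^ 4)
    \<le> \<Theta> ^ 3 * B\<^sup>2 * (\<Sum>j\<in>J. q ^ (j - k) * expectation (\<lambda>x. (g j x)\<^sup>2))"
proof -
  have w: "(\<Sum>j\<in>J. q ^ (j - k)) \<le> \<Theta>"
    using sum_q_power_diff_le[of J k 0] J by simp
  have "expectation (\<lambda>x. (\<Sum>j\<in>J. proj k (g j) x) ^ 4)
      \<le> expectation (\<lambda>x. (\<Sum>j\<in>J. q ^ (j - k)) ^ 3 * (\<Sum>j\<in>J. (proj k (g j) x) ^ 4 / (q ^ (j - k)) ^ 3))"
    using g q_pos by (intro integral_mono weighted_sum_fourth_power_le) auto
  also have "\<dots> = (\<Sum>j\<in>J. q ^ (j - k)) ^ 3 *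
      (\<Sum>j\<in>J. expectation (\<lambda>x. (proj k (g j) x) ^ 4) / (q ^ (j - k)) ^ 3)"
    using g by (simp add: Bochner_Integration.integral_sum)
  also have "\<dots> \<le> \<Theta> ^ 3 * (\<Sum>j\<in>J. B\<^sup>2 * (q ^ (j - k) * expectation (\<lambda>x. (g j x)\<^sup>2)))"
  proof (intro mult_mono w sum_mono power_mono)
    fix j assume j: "j \<in> J"
    have "AE x in M. \<bar>proj k (g j) x\<bar> \<le> B"
      using j g B by (intro proj_abs_le) auto
    then have "AE x in M. (proj k (g j) x) ^ 4 \<le> B\<^sup>2 * (proj k (g j) x)\<^sup>2"
    proof eventually_elim
      case (elim x)
      then have "(proj k (g j) x)\<^sup>2 \<le> B\<^sup>2"
        using power_mono[of "\<bar>proj k (g j) x\<bar>" B 2] by simp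
      then have "(proj k (g j) x)\<^sup>2 * (proj k (g j) x)\<^sup>2 \<le> B\<^sup>2 * (proj k (g j) x)\<^sup>2"
        by (intro mult_right_mono) auto
      then show ?case
        by (simp flip: power_add)
    qed
    then have "expectation (\<lambda>x. (proj k (g j) x) ^ 4) \<le> expectation (\<lambda>x. B\<^sup>2 * (proj k (g j) x)\<^sup>2)"
      using j g by (intro integral_mono_AE) auto
    also have "\<dots> = B\<^sup>2 * expectation (\<lambda>x. (proj k (g j) x)\<^sup>2)"
      by simp
    also have "\<dots> \<le> B\<^sup>2 * (q ^ (4 * (j - k)) * expectation (\<lambda>x. (g j x)\<^sup>2))"
      using j J g by (intro mult_left_mono proj_contraction_q) auto
    \<comment> \<open>All four powers of \<open>q\<close> are used here: three cancel the weight,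
      one is kept.\<close>
    also have "\<dots> = B\<^sup>2 * (q ^ (j - k) * expectation (\<lambda>x. (g j x)\<^sup>2)) * (q ^ (j - k)) ^ 3"
    proof -
      have "q ^ (4 * (j - k)) = (q ^ (j - k)) ^ 4"
        by (metis mult.commute power_mult)
      then show ?thesis
        by (simp add: power4_eq_xxxx power3_eq_cube mult_ac)
    qed
    finally show "expectation (\<lambda>x. (proj k (g j) x) ^ 4) / (q ^ (j - k)) ^ 3
        \<le> B\<^sup>2 * (q ^ (j - k) * expectation (\<lambda>x. (g j x)\<^sup>2))"
      using q_pos by (simp add: pos_divide_le_eq)
  qed (use q_pos q_less Theta_ge in \<open>auto intro!: sum_nonneg\<close>)
  finally show ?thesis
    by (simp add: sum_distrib_left mult_ac)
qed

end

section \<open>Potentials of a row and their near and far parts\<close>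

locale mixing_row = mixing_filtration M F G lam
  for M :: "'a measure" and F G lam + fixes n :: nat
begin

text \<open>The potential of a time-inhomogeneous chain: the predicted sum of \<open>g\<close> over
  the times after \<open>k\<close>. Its Poisson equation is
  \<open>expectation_pot_mult\<close>.\<close>

definition pot :: "(nat \<Rightarrow> 'a \<Rightarrow> real) \<Rightarrow> nat \<Rightarrow> 'a \<Rightarrow> real" where
  "pot g k x = (\<Sum>j\<in>{k<..n}. proj k (g j) x)"

text \<open>Lags above \<open>K\<close> are small in mean square, lags up to \<open>K\<close>
  (\<open>near\<close>) are bounded uniformly; the two parts are never estimated in the same
  norm.\<close>

definition far :: "nat \<Rightarrow> (nat \<Rightarrow> 'a \<Rightarrow> real) \<Rightarrow> nat \<Rightarrow> 'a \<Rightarrow> real" where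
  "far K g k x = (\<Sum>j\<in>{k + K<..n}. proj k (g j) x)"

definition near :: "nat \<Rightarrow> (nat \<Rightarrow> 'a \<Rightarrow> real) \<Rightarrow> nat \<Rightarrow> 'a \<Rightarrow> real" where
  "near K g k x = (\<Sum>j\<in>{k<..min n (k + K)}. proj k (g j) x)"

lemma pot_eq_far: "pot g k = far 0 g k"
  by (auto simp: pot_def far_def)

lemma pot_eq: "pot g k x = near K g k x + far K g k x"
proof -
  have "{k<..n} = {k<..min n (k + K)} \<union> {k + K<..n}" by auto
  then show ?thesis
    by (simp add: pot_def near_def far_def) (subst sum.union_disjoint, auto)
qed

lemma pot_n [simp]: "pot g n = (\<lambda>_. 0)"
  by (auto simp: pot_def)

lemma pot_measurable [measurable]: "pot g k \<in> borel_measurable (G k)"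
  and far_measurable [measurable]: "far K g k \<in> borel_measurable (G k)"
  and near_measurable [measurable]: "near K g k \<in> borel_measurable (G k)"
  unfolding pot_def[abs_def] far_def[abs_def] near_def[abs_def] by measurable

end

locale mixing_summands = mixing_row M F G lam n
  for M :: "'a measure" and F G lam n +
  fixes g :: "nat \<Rightarrow> 'a \<Rightarrow> real"
  assumes g_measurable: "\<And>j. g j \<in> borel_measurable (G j)"
    and g_bounded: "\<And>j. ess_bounded (g j)"
begin

lemma ess_bounded_pot: "ess_bounded (pot g k)" and ess_bounded_far: "ess_bounded (far K g k)"
  and ess_bounded_near: "ess_bounded (near K g k)"
  unfolding pot_def[abs_def] far_def[abs_def] near_def[abs_def]
  using g_bounded by auto

text \<open>The Poisson equation in weak form. Since \<open>\<psi>\<close> belongs to the past at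
  time \<open>k\<close> and hence at \<open>k + 1\<close>, both potentials may be replaced by the
  plain sums of the \<open>g j\<close>.\<close>

lemma expectation_pot_mult:
  assumes "k < n" "\<psi> \<in> borel_measurable (F k)" "ess_bounded \<psi>"
  shows "expectation (\<lambda>x. pot g k x * \<psi> x)
    = expectation (\<lambda>x. (g (Suc k) x + pot g (Suc k) x) * \<psi> x)"
proof -
  have *: "expectation (\<lambda>x. pot g i x * \<psi> x) = (\<Sum>j\<in>{i<..n}. expectation (\<lambda>x. g j x * \<psi> x))"
    if "k \<le> i" for i
  proof -
    have "expectation (\<lambda>x. pot g i x * \<psi> x) = (\<Sum>j\<in>{i<..n}. expectation (\<lambda>x. proj i (g j) x * \<psi> x))"
      using assms g_bounded
      by (simp add: pot_def sum_distrib_right Bochner_Integration.integral_sum)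
    also have "\<dots> = (\<Sum>j\<in>{i<..n}. expectation (\<lambda>x. g j x * \<psi> x))"
      using g_measurable g_bounded assms that measurable_F_le
      by (intro sum.cong expectation_proj_mult) auto
    finally show ?thesis .
  qed
  have "{k<..n} = insert (Suc k) {Suc k<..n}"
    using \<open>k < n\<close> by auto
  then have "expectation (\<lambda>x. pot g k x * \<psi> x) =
      expectation (\<lambda>x. g (Suc k) x * \<psi> x) + expectation (\<lambda>x. pot g (Suc k) x * \<psi> x)"
    by (simp add: *)
  also have "\<dots> = expectation (\<lambda>x. (g (Suc k) x + pot g (Suc k) x) * \<psi> x)"
    using g_bounded assms ess_bounded_pot by (simp add: distrib_right)
  finally show ?thesis .
qed

text \<open>There are at most \<open>K\<close> terms, and conditional expectation does not raise the
  sup bound \<open>B\<close>.\<close>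

lemma near_abs_le:
  assumes "\<And>j. j \<in> {1..n} \<Longrightarrow> AE x in M. \<bar>g j x\<bar> \<le> B" "0 \<le> B"
  shows "AE x in M. \<bar>near K g k x\<bar> \<le> real K * B"
proof -
  have "AE x in M. \<forall>j\<in>{k<..min n (k + K)}. \<bar>proj k (g j) x\<bar> \<le> B"
    using assms g_bounded by (intro AE_finite_allI proj_abs_le) auto
  then show ?thesis
  proof eventually_elim
    case (elim x)
    have "\<bar>near K g k x\<bar> \<le> (\<Sum>j\<in>{k<..min n (k + K)}. \<bar>proj k (g j) x\<bar>)"
      unfolding near_def by (rule sum_abs)
    also have "\<dots> \<le> real (card {k<..min n (k + K)}) * B"
      using elim by (intro sum_bounded_above) auto
    also have "\<dots> \<le> real K * B"
      using \<open>0 \<le> B\<close> by (intro mult_right_mono) auto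
    finally show ?case .
  qed
qed

end

locale centered_summands = mixing_summands M F G lam n g
  for M :: "'a measure" and F G lam n g +
  assumes g_centered: "\<And>j. expectation (g j) = 0"
begin

text \<open>One \<open>\<Theta>\<close> comes from Cauchy--Schwarz at fixed \<open>k\<close>, the
  other from summing over \<open>k\<close>; the result is linear in the second moments of the
  \<open>g j\<close>.\<close>

lemma sum_far_square_le:
  "(\<Sum>k\<le>n. expectation (\<lambda>x. (far K g k x)\<^sup>2))
    \<le> \<Theta>\<^sup>2 * q ^ K * (\<Sum>j\<in>{1..n}. expectation (\<lambda>x. (g j x)\<^sup>2))"
proof -
  have "(\<Sum>k\<le>n. expectation (\<lambda>x. (far K g k x)\<^sup>2))
      \<le> (\<Sum>k\<le>n. \<Theta> * (\<Sum>j\<in>{k + K<..n}. q ^ (j - k) * expectation (\<lambda>x. (g j x)\<^sup>2)))"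
    unfolding far_def
    by (intro sum_mono sum_proj_square_le g_measurable g_bounded g_centered) auto
  also have "\<dots> = \<Theta> * (\<Sum>k\<le>n. \<Sum>j\<in>{k + K<..n}. q ^ (j - k) * expectation (\<lambda>x. (g j x)\<^sup>2))"
    by (simp add: sum_distrib_left)
  also have "\<dots> \<le> \<Theta> * (q ^ K * \<Theta> * (\<Sum>j\<in>{1..n}. expectation (\<lambda>x. (g j x)\<^sup>2)))"
    using Theta_ge by (intro mult_left_mono double_sum_q_power_le) auto
  finally show ?thesis
    by (simp add: power2_eq_square mult_ac)
qed

lemma sum_pot_square_le:
  "(\<Sum>k\<le>n. expectation (\<lambda>x. (pot g k x)\<^sup>2)) \<le> \<Theta>\<^sup>2 * (\<Sum>j\<in>{1..n}. expectation (\<lambda>x. (g j x)\<^sup>2))"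
  using sum_far_square_le[of 0] by (simp add: pot_eq_far)

lemma sum_far_fourth_power_le:
  assumes "\<And>j. j \<in> {1..n} \<Longrightarrow> AE x in M. \<bar>g j x\<bar> \<le> B"
  shows "(\<Sum>k\<le>n. expectation (\<lambda>x. (far K g k x) ^ 4))
    \<le> \<Theta> ^ 4 * B\<^sup>2 * q ^ K * (\<Sum>j\<in>{1..n}. expectation (\<lambda>x. (g j x)\<^sup>2))"
proof -
  have "(\<Sum>k\<le>n. expectation (\<lambda>x. (far K g k x) ^ 4))
      \<le> (\<Sum>k\<le>n. \<Theta> ^ 3 * B\<^sup>2 * (\<Sum>j\<in>{k + K<..n}. q ^ (j - k) * expectation (\<lambda>x. (g j x)\<^sup>2)))"
    unfolding far_def
    by (intro sum_mono sum_proj_fourth_power_le g_measurable g_bounded g_centered assms) auto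
  also have "\<dots> = \<Theta> ^ 3 * B\<^sup>2 * (\<Sum>k\<le>n. \<Sum>j\<in>{k + K<..n}. q ^ (j - k) * expectation (\<lambda>x. (g j x)\<^sup>2))"
    by (simp add: sum_distrib_left)
  also have "\<dots> \<le> \<Theta> ^ 3 * B\<^sup>2 * (q ^ K * \<Theta> * (\<Sum>j\<in>{1..n}. expectation (\<lambda>x. (g j x)\<^sup>2)))"
    using Theta_ge by (intro mult_left_mono double_sum_q_power_le) auto
  finally show ?thesis
    by (simp add: power4_eq_xxxx power3_eq_cube mult_ac)
qed

lemma expectation_pot_square_le:
  assumes "\<And>j. j \<in> {1..n} \<Longrightarrow> AE x in M. \<bar>g j x\<bar> \<le> B" "0 \<le> B"
  shows "expectation (\<lambda>x. (pot g k x)\<^sup>2) \<le> \<Theta>\<^sup>2 * B\<^sup>2"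
proof -
  have le: "expectation (\<lambda>x. (g j x)\<^sup>2) \<le> B\<^sup>2" if "j \<in> {k<..n}" for j
  proof -
    have "expectation (\<lambda>x. (g j x)\<^sup>2) \<le> expectation (\<lambda>_. B\<^sup>2)"
    proof (rule integral_mono_AE)
      have "AE x in M. \<bar>g j x\<bar> \<le> B"
        using that by (intro assms(1)) auto
      then show "AE x in M. (g j x)\<^sup>2 \<le> B\<^sup>2"
      proof eventually_elim
        case (elim x)
        then show ?case
          using power_mono[of "\<bar>g j x\<bar>" B 2] by simp
      qed
    qed (use g_bounded in auto)
    then show ?thesis by (simp add: prob_space)
  qed
  have "expectation (\<lambda>x. (pot g k x)\<^sup>2)
      \<le> \<Theta> * (\<Sum>j\<in>{k<..n}. q ^ (j - k) * expectation (\<lambda>x. (g j x)\<^sup>2))"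
    unfolding pot_def by (intro sum_proj_square_le g_measurable g_bounded g_centered) auto
  also have "\<dots> \<le> \<Theta> * ((\<Sum>j\<in>{k<..n}. q ^ (j - k)) * B\<^sup>2)"
    using Theta_ge q_pos unfolding sum_distrib_right
    by (intro mult_left_mono sum_mono le) auto
  also have "\<dots> \<le> \<Theta> * ((q ^ 0 * \<Theta>) * B\<^sup>2)"
    using Theta_ge by (intro mult_left_mono mult_right_mono sum_q_power_diff_le) auto
  finally show ?thesis
    by (simp add: power2_eq_square)
qed

end

subsection \<open>Martingale decomposition\<close>

locale mixing_chain = centered_summands M F G lam n X
  for M :: "'a measure" and F G lam n X +
  fixes C :: real
  assumes X_le: "\<And>j. j \<in> {1..n} \<Longrightarrow> AE x in M. \<bar>X j x\<bar> \<le> C"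
    and C_pos: "0 < C"
begin

definition H :: "nat \<Rightarrow> 'a \<Rightarrow> real" where "H = pot X"

text \<open>The sum from time \<open>k\<close> on, \<open>k\<close> included, as predicted at time
  \<open>k\<close>; hence \<open>H k\<close> is the prediction of \<open>Z (Suc k)\<close>.\<close>

definition Z :: "nat \<Rightarrow> 'a \<Rightarrow> real" where "Z k x = X k x + H k x"

definition D :: "nat \<Rightarrow> 'a \<Rightarrow> real" where "D k x = Z (Suc k) x - H k x"

definition W :: "nat \<Rightarrow> 'a \<Rightarrow> real" where "W k x = (X k x)\<^sup>2 + 2 * X k x * H k x"

text \<open>
  \<open>Q k\<close> is the conditional expectation of \<open>D k\<^sup>2 + \<dots> + D (n - 1)\<^sup>2\<close> at time \<open>k\<close>: the summands
  telescope because \<open>W = Z\<^sup>2 - H\<^sup>2\<close>.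
\<close>

definition Q :: "nat \<Rightarrow> 'a \<Rightarrow> real" where "Q k x = pot W k x - (H k x)\<^sup>2"

definition S :: "nat \<Rightarrow> 'a \<Rightarrow> real" where "S k x = (\<Sum>i=1..k. X i x)"

definition v :: real where "v = expectation (\<lambda>x. (S n x)\<^sup>2)"

definition bsq :: real where "bsq = (\<Sum>j=1..n. expectation (\<lambda>x. (X j x)\<^sup>2))"

lemma measurable_H [measurable]: "H k \<in> borel_measurable (G k)"
  unfolding H_def by measurable

lemma measurable_Z [measurable]: "Z k \<in> borel_measurable (G k)"
  using g_measurable[of k] unfolding Z_def[abs_def] by measurable

lemma measurable_W [measurable]: "W k \<in> borel_measurable (G k)"
  using g_measurable[of k] unfolding W_def[abs_def] by measurable

lemma measurable_Q [measurable]: "Q k \<in> borel_measurable (G k)"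
  unfolding Q_def[abs_def] by measurable

lemma measurable_S: "S k \<in> borel_measurable (F k)"
  unfolding S_def[abs_def] by (intro borel_measurable_sum measurable_GF[OF g_measurable]) auto

lemma measurable_GF_le: "f \<in> borel_measurable (G k) \<Longrightarrow> f \<in> borel_measurable (F k)"
  by (rule measurable_GF) auto

lemma bounded_X [simp]: "ess_bounded (X k)"
  by (rule g_bounded)

lemma bounded_H [simp]: "ess_bounded (H k)"
  unfolding H_def by (rule ess_bounded_pot)

lemma bounded_Z [simp]: "ess_bounded (Z k)"
  unfolding Z_def[abs_def] by simp

lemma bounded_D [simp]: "ess_bounded (D k)"
  unfolding D_def[abs_def] by simp

lemma bounded_W [simp]: "ess_bounded (W k)"
  unfolding W_def[abs_def] by simp

sublocale W: mixing_summands M F G lam n W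
  by unfold_locales auto

lemma bounded_Q [simp]: "ess_bounded (Q k)"
  unfolding Q_def[abs_def] using W.ess_bounded_pot by simp

lemma bounded_S [simp]: "ess_bounded (S k)"
  unfolding S_def[abs_def] by simp

lemma H_n [simp]: "H n = (\<lambda>_. 0)" and Q_n [simp]: "Q n = (\<lambda>_. 0)"
  by (auto simp: H_def Q_def)

lemma expectation_H_mult:
  assumes "k < n" "\<psi> \<in> borel_measurable (F k)" "ess_bounded \<psi>"
  shows "expectation (\<lambda>x. H k x * \<psi> x) = expectation (\<lambda>x. Z (Suc k) x * \<psi> x)"
  unfolding H_def Z_def using expectation_pot_mult[OF assms] by simp

lemma expectation_D_mult:
  assumes "k < n" "\<psi> \<in> borel_measurable (F k)" "ess_bounded \<psi>"
  shows "expectation (\<lambda>x. D k x * \<psi> x) = 0"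
  using expectation_H_mult[OF assms] assms by (simp add: D_def left_diff_distrib)

text \<open>The recursion \<open>Q k = E\<^sub>k (Q (Suc k) + (D k)\<^sup>2)\<close>, tested against
  the past: it combines the Poisson equation of \<open>W\<close> with the martingale property of
  \<open>D\<close>.\<close>

lemma expectation_Q_mult:
  assumes "k < n" "\<psi> \<in> borel_measurable (F k)" "ess_bounded \<psi>"
  shows "expectation (\<lambda>x. Q k x * \<psi> x) = expectation (\<lambda>x. (Q (Suc k) x + (D k x)\<^sup>2) * \<psi> x)"
proof -
  have Hp: "(\<lambda>x. H k x * \<psi> x) \<in> borel_measurable (F k)" "ess_bounded (\<lambda>x. H k x * \<psi> x)"
    using assms measurable_GF_le[OF measurable_H] by auto
  \<comment> \<open>Expanding \<open>D = Z - H\<close> leaves the cross term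
    \<open>- 2 * D k * H k\<close>, in which \<open>H k\<close> counts as part of the test
    function.\<close>
  have *: "(Q (Suc k) x + (D k x)\<^sup>2) * \<psi> x - Q k x * \<psi> x =
      ((W (Suc k) x + pot W (Suc k) x) * \<psi> x - pot W k x * \<psi> x) - 2 * (D k x * (H k x * \<psi> x))" for x
    unfolding Q_def D_def Z_def W_def by (simp add: power2_eq_square algebra_simps)
  have "expectation (\<lambda>x. (Q (Suc k) x + (D k x)\<^sup>2) * \<psi> x) - expectation (\<lambda>x. Q k x * \<psi> x)
      = expectation (\<lambda>x. (Q (Suc k) x + (D k x)\<^sup>2) * \<psi> x - Q k x * \<psi> x)"
    using assms by simp
  also have "\<dots> = (expectation (\<lambda>x. (W (Suc k) x + pot W (Suc k) x) * \<psi> x)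
      - expectation (\<lambda>x. pot W k x * \<psi> x)) - 2 * expectation (\<lambda>x. D k x * (H k x * \<psi> x))"
    unfolding * using assms W.ess_bounded_pot by simp
  also have "\<dots> = 0"
    using W.expectation_pot_mult[OF assms] expectation_D_mult[OF \<open>k < n\<close> Hp] by simp
  finally show ?thesis by simp
qed

text \<open>Backward induction from \<open>Q n = 0\<close>: the recursion, tested on the set where
  \<open>Q k\<close> is negative, shows that this set is null.\<close>

lemma Q_nonneg:
  assumes "k \<le> n"
  shows "AE x in M. 0 \<le> Q k x"
  using assms
proof (induction k rule: inc_induct)
  case base
  then show ?case by simp
next
  case (step k)
  define A where "A = {x \<in> space M. Q k x < 0}"
  have "A = {x \<in> space (F k). Q k x < 0}"
    using subalg_F[of k] by (simp add: A_def subalgebra_def)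
  also have "\<dots> \<in> sets (F k)"
    using measurable_GF_le[OF measurable_Q[of k]] by measurable
  finally have AF: "A \<in> sets (F k)" .
  then have AM: "A \<in> sets M"
    using subalg_F[of k] by (auto simp: subalgebra_def)
  have le: "Q k x * indicator A x \<le> 0" for x
    by (auto simp: A_def indicator_def)
  have "0 \<le> expectation (\<lambda>x. (Q (Suc k) x + (D k x)\<^sup>2) * indicator A x)"
    using step.IH by (intro integral_nonneg_AE) (auto simp: indicator_def)
  also have "\<dots> = expectation (\<lambda>x. Q k x * indicator A x)"
    using AF AM step by (intro expectation_Q_mult[symmetric]) auto
  finally have "expectation (\<lambda>x. - (Q k x * indicator A x)) \<le> 0"
    by simp
  moreover have "0 \<le> expectation (\<lambda>x. - (Q k x * indicator A x))"
    using le by (intro integral_nonneg_AE AE_I2) simp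
  ultimately have "expectation (\<lambda>x. - (Q k x * indicator A x)) = 0"
    by simp
  then have "AE x in M. - (Q k x * indicator A x) = 0"
    using AM le by (subst (asm) integral_nonneg_eq_0_iff_AE) auto
  then show ?case
    by (rule AE_mp) (auto intro!: AE_I2 simp: A_def indicator_def split: if_splits)
qed

lemma expectation_H [simp]: "expectation (H k) = 0"
  unfolding H_def pot_def[abs_def] by (simp add: Bochner_Integration.integral_sum g_centered)

lemma expectation_Z [simp]: "expectation (Z k) = 0"
  unfolding Z_def[abs_def] by (simp add: g_centered)

lemma expectation_D_square:
  assumes "k < n"
  shows "expectation (\<lambda>x. (D k x)\<^sup>2) = expectation (Q k) - expectation (Q (Suc k))"
  using expectation_Q_mult[OF assms, of "\<lambda>_. 1"] by simp

lemma S_plus_H_Suc: "S (Suc k) x + H (Suc k) x = S k x + H k x + D k x"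
  by (simp add: S_def D_def Z_def)

lemma AE_F_0:
  assumes "f \<in> borel_measurable (F 0)" "ess_bounded f"
  shows "AE x in M. f x = expectation f"
proof -
  have "sets (F 0) = {{}, space (F 0)}" and sp: "space (F 0) = space M"
    using F_0 subalg_F[of 0] by (auto simp: subalgebra_def)
  with assms(1) obtain c where const: "\<And>x. x \<in> space M \<Longrightarrow> f x = c"
    by (metis measurable_trivial_const)
  then have "expectation f = expectation (\<lambda>_. c)"
    by (intro Bochner_Integration.integral_cong) auto
  then show ?thesis
    using const by (intro AE_I2) (simp add: prob_space)
qed

lemma H_0: "AE x in M. H 0 x = 0"
  using AE_F_0[of "H 0"] measurable_GF_le[OF measurable_H] by simp

text \<open>Pythagoras: \<open>D k\<close> is orthogonal to \<open>S k + H k\<close>. At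
  \<open>k = n\<close> this yields \<open>v = E (Q 0)\<close>.\<close>

lemma expectation_S_plus_H_square:
  assumes "k \<le> n"
  shows "expectation (\<lambda>x. (S k x + H k x)\<^sup>2) = expectation (Q 0) - expectation (Q k)"
  using assms
proof (induction k)
  case 0
  have "expectation (\<lambda>x. (S 0 x + H 0 x)\<^sup>2) = expectation (\<lambda>_. 0)"
    using H_0 by (intro integral_cong_AE) (auto simp: S_def ess_bounded_measurable)
  then show ?case by simp
next
  case (Suc k)
  have m: "(\<lambda>x. S k x + H k x) \<in> borel_measurable (F k)"
    using measurable_S measurable_GF_le[OF measurable_H] by auto
  have "expectation (\<lambda>x. (S (Suc k) x + H (Suc k) x)\<^sup>2)
      = expectation (\<lambda>x. (S k x + H k x)\<^sup>2 + 2 * (D k x * (S k x + H k x)) + (D k x)\<^sup>2)"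
    unfolding S_plus_H_Suc by (simp add: power2_eq_square algebra_simps)
  also have "\<dots> = expectation (\<lambda>x. (S k x + H k x)\<^sup>2) + 2 * expectation (\<lambda>x. D k x * (S k x + H k x))
      + expectation (\<lambda>x. (D k x)\<^sup>2)"
    by simp
  also have "\<dots> = expectation (Q 0) - expectation (Q (Suc k))"
    using Suc expectation_D_mult[of k, OF _ m] expectation_D_square[of k] by simp
  finally show ?case .
qed

lemma v_eq: "v = expectation (Q 0)"
  using expectation_S_plus_H_square[of n] by (simp add: v_def)

lemma v_nonneg: "0 \<le> v"
  by (simp add: v_def)

lemma Q_0: "AE x in M. Q 0 x = v"
  unfolding v_eq using measurable_GF_le[OF measurable_Q] by (intro AE_F_0) auto

lemma sum_expectation_D_square: "(\<Sum>k<n. expectation (\<lambda>x. (D k x)\<^sup>2)) = v"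
proof -
  have "(\<Sum>k<n. expectation (\<lambda>x. (D k x)\<^sup>2)) = (\<Sum>k<n. expectation (Q k) - expectation (Q (Suc k)))"
    by (intro sum.cong expectation_D_square) auto
  also have "\<dots> = v"
    using sum_lessThan_telescope'[of "\<lambda>k. expectation (Q k)" n] by (simp add: v_eq)
  finally show ?thesis .
qed

text \<open>\<open>H k\<close> is the projection of the mean zero \<open>Z (Suc k)\<close>, but is
  known only through test functions. Testing with \<open>H k\<close> itself, Cauchy--Schwarz gives
  \<open>h\<^sup>2 \<le> c * h\<close> with \<open>c\<close> the claimed bound, and \<open>h\<close>
  cancels.\<close>

lemma expectation_H_square_le:
  assumes "k < n"
  shows "expectation (\<lambda>x. (H k x)\<^sup>2) \<le> (1 - lam)\<^sup>2 * expectation (\<lambda>x. (Z (Suc k) x)\<^sup>2)"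
proof -
  define h where "h = expectation (\<lambda>x. (H k x)\<^sup>2)"
  have "h = expectation (\<lambda>x. H k x * H k x)"
    by (simp add: h_def power2_eq_square)
  also have "\<dots> = expectation (\<lambda>x. Z (Suc k) x * H k x)"
    using assms measurable_GF_le[OF measurable_H] by (intro expectation_H_mult) auto
  also have "\<dots> = expectation (\<lambda>x. proj k (Z (Suc k)) x * H k x)"
    using measurable_GF_le[OF measurable_H] by (intro expectation_proj_mult_Suc[symmetric]) auto
  finally have "h\<^sup>2 = (expectation (\<lambda>x. proj k (Z (Suc k)) x * H k x))\<^sup>2"
    by simp
  also have "\<dots> \<le> expectation (\<lambda>x. (proj k (Z (Suc k)) x)\<^sup>2) * h"
    unfolding h_def by (intro expectation_mult_sq_le) (auto simp: ess_bounded_measurable)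
  also have "\<dots> \<le> ((1 - lam)\<^sup>2 * expectation (\<lambda>x. (Z (Suc k) x)\<^sup>2)) * h"
    using proj_contraction[of "Z (Suc k)" "Suc k" k]
    by (intro mult_right_mono) (auto simp: h_def Suc_diff_le)
  finally have le: "h * h \<le> ((1 - lam)\<^sup>2 * expectation (\<lambda>x. (Z (Suc k) x)\<^sup>2)) * h"
    by (simp add: power2_eq_square)
  have "0 \<le> h" "0 \<le> (1 - lam)\<^sup>2 * expectation (\<lambda>x. (Z (Suc k) x)\<^sup>2)"
    by (auto simp: h_def)
  then have "h \<le> (1 - lam)\<^sup>2 * expectation (\<lambda>x. (Z (Suc k) x)\<^sup>2)"
    using le by (cases "h = 0") (auto simp: mult_le_cancel_right)
  then show ?thesis by (simp add: h_def)
qed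

text \<open>\<open>E D\<^sup>2 = E Z\<^sup>2 - E H\<^sup>2\<close> by orthogonality, and
  \<open>1 - (1 - lam)\<^sup>2 \<ge> lam\<close>.\<close>

lemma expectation_D_square_ge:
  assumes "k < n"
  shows "lam * expectation (\<lambda>x. (Z (Suc k) x)\<^sup>2) \<le> expectation (\<lambda>x. (D k x)\<^sup>2)"
proof -
  let ?z = "expectation (\<lambda>x. (Z (Suc k) x)\<^sup>2)"
  have "expectation (\<lambda>x. (D k x)\<^sup>2)
      = expectation (\<lambda>x. (Z (Suc k) x)\<^sup>2 - 2 * (Z (Suc k) x * H k x) + H k x * H k x)"
    unfolding D_def by (simp add: power2_eq_square algebra_simps)
  also have "\<dots> = ?z - 2 * expectation (\<lambda>x. Z (Suc k) x * H k x) + expectation (\<lambda>x. H k x * H k x)"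
    by simp
  also have "\<dots> = ?z - expectation (\<lambda>x. (H k x)\<^sup>2)"
    using expectation_H_mult[OF assms, of "H k"] measurable_GF_le[OF measurable_H]
    by (simp add: power2_eq_square)
  finally have "?z - (1 - lam)\<^sup>2 * ?z \<le> expectation (\<lambda>x. (D k x)\<^sup>2)"
    using expectation_H_square_le[OF assms] by simp
  moreover have "lam * ?z \<le> ?z - (1 - lam)\<^sup>2 * ?z"
  proof -
    have "(1 - lam)\<^sup>2 \<le> 1 - lam"
      using lam_pos lam_le power_decreasing[of 1 2 "1 - lam"] by simp
    then have "(1 - lam)\<^sup>2 * ?z \<le> (1 - lam) * ?z"
      by (rule mult_right_mono) simp
    then show ?thesis by (simp add: algebra_simps)
  qed
  ultimately show ?thesis by linarith
qed

text \<open>Since \<open>X = Z - H\<close>, and each \<open>H k\<close> is dominated by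
  \<open>Z (Suc k)\<close>, everything reduces to the second moments of \<open>Z\<close>, which
  \<open>lam\<close> compares with those of \<open>D\<close>. This excludes a degenerate variance by
  cancellation.\<close>

lemma bsq_le: "bsq \<le> 4 * v / lam"
proof -
  define z where "z = (\<Sum>k<n. expectation (\<lambda>x. (Z (Suc k) x)\<^sup>2))"
  have "lam * z \<le> v"
    unfolding z_def sum_distrib_left sum_expectation_D_square[symmetric]
    by (intro sum_mono expectation_D_square_ge) auto
  have H_Z: "expectation (\<lambda>x. (H k x)\<^sup>2) \<le> expectation (\<lambda>x. (Z (Suc k) x)\<^sup>2)" if "k < n" for k
  proof -
    have "(1 - lam)\<^sup>2 \<le> 1"
      using lam_pos lam_le by (simp add: power_le_one)
    then have "(1 - lam)\<^sup>2 * expectation (\<lambda>x. (Z (Suc k) x)\<^sup>2) \<le> 1 * expectation (\<lambda>x. (Z (Suc k) x)\<^sup>2)"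
      by (intro mult_right_mono) auto
    with expectation_H_square_le[OF that] show ?thesis by simp
  qed
  have X_Z: "expectation (\<lambda>x. (X k x)\<^sup>2)
      \<le> 2 * expectation (\<lambda>x. (Z k x)\<^sup>2) + 2 * expectation (\<lambda>x. (H k x)\<^sup>2)" for k
  proof -
    have "expectation (\<lambda>x. (X k x)\<^sup>2) \<le> expectation (\<lambda>x. 2 * (Z k x)\<^sup>2 + 2 * (H k x)\<^sup>2)"
    proof (rule integral_mono)
      fix x
      show "(X k x)\<^sup>2 \<le> 2 * (Z k x)\<^sup>2 + 2 * (H k x)\<^sup>2"
        using square_diff_le[of "Z k x" "H k x"] by (simp add: Z_def)
    qed auto
    then show ?thesis by simp
  qed
  have sH: "(\<Sum>k<n. expectation (\<lambda>x. (H (Suc k) x)\<^sup>2)) \<le> z"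
  proof -
    \<comment> \<open>The shift adds the nonnegative term at \<open>0\<close>; the term at
      \<open>n\<close> vanishes as \<open>H n = 0\<close>.\<close>
    have "(\<Sum>k<n. expectation (\<lambda>x. (H (Suc k) x)\<^sup>2)) \<le> (\<Sum>k<Suc n. expectation (\<lambda>x. (H k x)\<^sup>2))"
      by (subst sum.lessThan_Suc_shift) simp
    also have "\<dots> \<le> z"
      using H_Z by (auto simp: z_def intro!: sum_mono)
    finally show ?thesis .
  qed
  have "bsq = (\<Sum>k<n. expectation (\<lambda>x. (X (Suc k) x)\<^sup>2))"
    unfolding bsq_def by (rule sum.reindex_bij_witness[of _ Suc "\<lambda>k. k - 1"]) auto
  also have "\<dots> \<le> (\<Sum>k<n. 2 * expectation (\<lambda>x. (Z (Suc k) x)\<^sup>2) + 2 * expectation (\<lambda>x. (H (Suc k) x)\<^sup>2))"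
    by (intro sum_mono X_Z)
  also have "\<dots> \<le> 4 * z"
    using sH by (simp add: sum.distrib z_def flip: sum_distrib_left)
  also have "\<dots> \<le> 4 * v / lam"
    using \<open>lam * z \<le> v\<close> lam_pos by (simp add: field_simps)
  finally show ?thesis .
qed

end

subsection \<open>Fourth moments and the quadratic potential\<close>

text \<open>\<open>\<Theta> ^ 4\<close> is the highest power that occurs: in the fourth moments of
  \<open>far K X\<close>, and for \<open>W2\<close>, where two potentials follow each other. The
  factor \<open>8\<close> is slack; the estimate behind \<open>Theta_q_power_le\<close> even yields
  \<open>v\<close>.\<close>

locale mixing_chain_window = mixing_chain M F G lam n X C
  for M :: "'a measure" and F G lam n X C +
  fixes K :: nat
  assumes Theta_le_K: "\<Theta> \<le> real K"
    and tail_le: "\<Theta> ^ 4 * q ^ K * bsq \<le> 8 * v"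
begin

definition A :: real where "A = (real K * C)\<^sup>2"

lemma K_ge_1: "1 \<le> real K"
  using Theta_le_K Theta_ge by linarith

lemma C_square_le: "C\<^sup>2 \<le> A"
  using K_ge_1 C_pos by (simp add: A_def power_mult_distrib one_le_power)

lemma A_nonneg: "0 \<le> A"
  by (simp add: A_def)

lemma bsq_nonneg: "0 \<le> bsq"
  unfolding bsq_def by (intro sum_nonneg) simp

lemma tail_nonneg: "0 \<le> \<Theta> ^ 4 * q ^ K * bsq"
  using Theta_ge q_pos bsq_nonneg by (intro mult_nonneg_nonneg zero_le_power) auto

lemma tail_square_le: "\<Theta>\<^sup>2 * q ^ K * bsq \<le> 8 * v"
proof -
  have "\<Theta>\<^sup>2 * (q ^ K * bsq) \<le> \<Theta> ^ 4 * (q ^ K * bsq)"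
    using Theta_ge q_pos bsq_nonneg by (intro mult_right_mono power_increasing) auto
  then show ?thesis using tail_le by (simp add: mult_ac)
qed

lemma near_X_le: "AE x in M. \<bar>near K X k x\<bar> \<le> real K * C"
  using C_pos by (intro near_abs_le X_le) auto

lemma H_eq: "H k x = near K X k x + far K X k x"
  unfolding H_def by (rule pot_eq)

lemma sum_far_X_square_le: "(\<Sum>k\<le>n. expectation (\<lambda>x. (far K X k x)\<^sup>2)) \<le> 8 * v"
  using sum_far_square_le[of K] tail_square_le by (simp add: bsq_def)

lemma sum_far_X_fourth_power_le: "(\<Sum>k\<le>n. expectation (\<lambda>x. (far K X k x) ^ 4)) \<le> 8 * A * v"
proof -
  have "(\<Sum>k\<le>n. expectation (\<lambda>x. (far K X k x) ^ 4)) \<le> \<Theta> ^ 4 * C\<^sup>2 * q ^ K * bsq"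
    unfolding bsq_def by (intro sum_far_fourth_power_le X_le)
  also have "\<dots> = C\<^sup>2 * (\<Theta> ^ 4 * q ^ K * bsq)"
    by simp
  also have "\<dots> \<le> A * (8 * v)"
    by (intro mult_mono C_square_le tail_le A_nonneg tail_nonneg)
  finally show ?thesis by simp
qed

lemma sum_shift_le:
  fixes f :: "nat \<Rightarrow> real"
  assumes "\<And>k. 0 \<le> f k"
  shows "(\<Sum>k<n. f (Suc k)) \<le> (\<Sum>k\<le>n. f k)" "(\<Sum>k<n. f k) \<le> (\<Sum>k\<le>n. f k)"
proof -
  have "(\<Sum>k\<le>n. f k) = f 0 + (\<Sum>k<n. f (Suc k))"
    by (rule sum.atMost_shift)
  with assms[of 0] show "(\<Sum>k<n. f (Suc k)) \<le> (\<Sum>k\<le>n. f k)" by simp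
  show "(\<Sum>k<n. f k) \<le> (\<Sum>k\<le>n. f k)"
    using assms by (intro sum_mono2) auto
qed

text \<open>The near part \<open>a\<close> of \<open>D\<close> is bounded by
  \<open>3 * K * C\<close>. Only two of its four powers are estimated so; the other two are turned
  back into \<open>(D k)\<^sup>2\<close>, whose expectations sum to \<open>v\<close>.\<close>

lemma D_fourth_power_le:
  assumes "k < n"
  shows "AE x in M. (D k x) ^ 4 \<le> 144 * A * ((D k x)\<^sup>2 + 2 * (far K X (Suc k) x)\<^sup>2 + 2 * (far K X k x)\<^sup>2)
    + 64 * ((far K X (Suc k) x) ^ 4 + (far K X k x) ^ 4)"
proof -
  have "AE x in M. \<bar>X (Suc k) x\<bar> \<le> C"
    using assms by (intro X_le) auto
  then show ?thesis
    using near_X_le[of k] near_X_le[of "Suc k"]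
  proof eventually_elim
    case (elim x)
    define a where "a = X (Suc k) x + near K X (Suc k) x - near K X k x"
    define b where "b = far K X (Suc k) x - far K X k x"
    have D: "D k x = a + b"
      by (simp add: D_def Z_def H_eq a_def b_def)
    have b2: "b\<^sup>2 \<le> 2 * (far K X (Suc k) x)\<^sup>2 + 2 * (far K X k x)\<^sup>2"
      unfolding b_def by (rule square_diff_le)
    have b4: "b ^ 4 \<le> 8 * (far K X (Suc k) x) ^ 4 + 8 * (far K X k x) ^ 4"
      unfolding b_def by (rule fourth_power_diff_le)
    have "1 * C \<le> real K * C"
      using K_ge_1 C_pos by (intro mult_right_mono) auto
    then have "\<bar>a\<bar> \<le> 3 * (real K * C)"
      using elim unfolding a_def by linarith
    then have "\<bar>a\<bar>\<^sup>2 \<le> (3 * (real K * C))\<^sup>2"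
      by (intro power_mono) auto
    then have "a\<^sup>2 \<le> 9 * A"
      by (simp add: A_def power_mult_distrib)
    then have "a\<^sup>2 * a\<^sup>2 \<le> 9 * A * a\<^sup>2"
      by (intro mult_right_mono) auto
    moreover have "a\<^sup>2 \<le> 2 * (D k x)\<^sup>2 + 2 * b\<^sup>2"
      using square_diff_le[of "D k x" b] D by simp
    ultimately have "a ^ 4 \<le> 9 * A * (2 * (D k x)\<^sup>2 + 2 * b\<^sup>2)"
      using A_nonneg mult_left_mono[of "a\<^sup>2" "2 * (D k x)\<^sup>2 + 2 * b\<^sup>2" "9 * A"]
      by (simp flip: power_add)
    also have "\<dots> \<le> 9 * A * (2 * (D k x)\<^sup>2 + 2 * (2 * (far K X (Suc k) x)\<^sup>2 + 2 * (far K X k x)\<^sup>2))"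
      using A_nonneg b2 by (intro mult_left_mono) auto
    finally have a4: "a ^ 4 \<le> 18 * (A * ((D k x)\<^sup>2 + 2 * (far K X (Suc k) x)\<^sup>2 + 2 * (far K X k x)\<^sup>2))"
      by (simp add: algebra_simps)
    have "(D k x) ^ 4 \<le> 8 * a ^ 4 + 8 * b ^ 4"
      unfolding D by (rule fourth_power_add_le)
    with a4 b4 show ?case
      by simp
  qed
qed

lemma bounded_far_X [simp]: "ess_bounded (far K' X k)"
  by (rule ess_bounded_far)

lemma bounded_near_X [simp]: "ess_bounded (near K' X k)"
  by (rule ess_bounded_near)

lemma sum_D_fourth_power_le: "(\<Sum>k<n. expectation (\<lambda>x. (D k x) ^ 4)) \<le> 6000 * A * v"
proof -
  let ?f2 = "\<lambda>k. expectation (\<lambda>x. (far K X k x)\<^sup>2)" and ?f4 = "\<lambda>k. expectation (\<lambda>x. (far K X k x) ^ 4)"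
  have "(\<Sum>k<n. expectation (\<lambda>x. (D k x) ^ 4))
      \<le> (\<Sum>k<n. 144 * A * (expectation (\<lambda>x. (D k x)\<^sup>2) + 2 * ?f2 (Suc k) + 2 * ?f2 k)
          + 64 * (?f4 (Suc k) + ?f4 k))"
  proof (rule sum_mono)
    fix k assume "k \<in> {..<n}"
    then have "expectation (\<lambda>x. (D k x) ^ 4)
      \<le> expectation (\<lambda>x. 144 * A * ((D k x)\<^sup>2 + 2 * (far K X (Suc k) x)\<^sup>2 + 2 * (far K X k x)\<^sup>2)
        + 64 * ((far K X (Suc k) x) ^ 4 + (far K X k x) ^ 4))"
      by (intro integral_mono_AE D_fourth_power_le) auto
    also have "\<dots> = 144 * A * (expectation (\<lambda>x. (D k x)\<^sup>2) + 2 * ?f2 (Suc k) + 2 * ?f2 k)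
        + 64 * (?f4 (Suc k) + ?f4 k)"
      by simp
    finally show "expectation (\<lambda>x. (D k x) ^ 4)
      \<le> 144 * A * (expectation (\<lambda>x. (D k x)\<^sup>2) + 2 * ?f2 (Suc k) + 2 * ?f2 k)
          + 64 * (?f4 (Suc k) + ?f4 k)" .
  qed
  also have "\<dots> = 144 * A * (v + 2 * (\<Sum>k<n. ?f2 (Suc k)) + 2 * (\<Sum>k<n. ?f2 k))
      + 64 * ((\<Sum>k<n. ?f4 (Suc k)) + (\<Sum>k<n. ?f4 k))"
    by (simp add: sum.distrib sum_expectation_D_square flip: sum_distrib_left)
  also have "\<dots> \<le> 144 * A * (v + 2 * (8 * v) + 2 * (8 * v)) + 64 * (8 * A * v + 8 * A * v)"
  proof -
    have "(\<Sum>k<n. ?f2 (Suc k)) \<le> 8 * v" "(\<Sum>k<n. ?f2 k) \<le> 8 * v"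
      by (rule order_trans[OF sum_shift_le(1) sum_far_X_square_le], simp)
        (rule order_trans[OF sum_shift_le(2) sum_far_X_square_le], simp)
    moreover have "(\<Sum>k<n. ?f4 (Suc k)) \<le> 8 * A * v" "(\<Sum>k<n. ?f4 k) \<le> 8 * A * v"
      by (rule order_trans[OF sum_shift_le(1) sum_far_X_fourth_power_le], simp)
        (rule order_trans[OF sum_shift_le(2) sum_far_X_fourth_power_le], simp)
    ultimately show ?thesis
      using A_nonneg by (intro add_mono mult_left_mono) auto
  qed
  \<comment> \<open>The exact constant is \<open>144 * 33 + 64 * 16 = 5776\<close>.\<close>
  also have "\<dots> \<le> 6000 * A * v"
    using mult_nonneg_nonneg[OF A_nonneg v_nonneg] by (simp add: algebra_simps)
  finally show ?thesis .
qed

text \<open>\<open>W\<close> is split along \<open>H = near + far\<close>. Both halves are centered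
  so that the contraction applies: \<open>W1\<close> is bounded, while \<open>W2\<close> is small in
  mean square.\<close>

definition W1 :: "nat \<Rightarrow> 'a \<Rightarrow> real" where
  "W1 j x = (X j x)\<^sup>2 + 2 * X j x * near K X j x
    - expectation (\<lambda>x. (X j x)\<^sup>2 + 2 * X j x * near K X j x)"

definition W2 :: "nat \<Rightarrow> 'a \<Rightarrow> real" where
  "W2 j x = 2 * X j x * far K X j x - expectation (\<lambda>x. 2 * X j x * far K X j x)"

lemma expectation_minus_mean: "ess_bounded f \<Longrightarrow> expectation (\<lambda>x. f x - expectation f) = 0"
  by (simp add: prob_space)

lemma variance_le: "ess_bounded f \<Longrightarrow> expectation (\<lambda>x. (f x - expectation f)\<^sup>2) \<le> expectation (\<lambda>x. (f x)\<^sup>2)"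
  using variance_eq[of f] by simp

sublocale W1: centered_summands M F G lam n W1
proof
  fix j
  show "W1 j \<in> borel_measurable (G j)"
    using g_measurable[of j] unfolding W1_def[abs_def] by measurable
  show "ess_bounded (W1 j)"
    unfolding W1_def[abs_def] by simp
  show "expectation (W1 j) = 0"
    unfolding W1_def[abs_def] by (rule expectation_minus_mean) simp
qed

sublocale W2: centered_summands M F G lam n W2
proof
  fix j
  show "W2 j \<in> borel_measurable (G j)"
    using g_measurable[of j] unfolding W2_def[abs_def] by measurable
  show "ess_bounded (W2 j)"
    unfolding W2_def[abs_def] by simp
  show "expectation (W2 j) = 0"
    unfolding W2_def[abs_def] by (rule expectation_minus_mean) simp
qed

lemma proj_add3:
  assumes "ess_bounded f" "ess_bounded g"
  shows "AE x in M. proj k (\<lambda>x. f x + g x + c) x = proj k f x + proj k g x + c"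
proof -
  interpret S: sigma_finite_subalgebra M "G k" by (rule sigma_finite_subalg[OF subalg_MG])
  have "AE x in M. proj k (\<lambda>x. f x + g x + c) x = proj k (\<lambda>x. f x + g x) x + proj k (\<lambda>_. c) x"
    unfolding proj_def using assms by (intro S.real_cond_exp_add) auto
  moreover have "AE x in M. proj k (\<lambda>x. f x + g x) x = proj k f x + proj k g x"
    unfolding proj_def using assms by (intro S.real_cond_exp_add) auto
  moreover have "AE x in M. proj k (\<lambda>_. c) x = c"
    by (intro proj_AE_self) auto
  ultimately show ?thesis
    by eventually_elim simp
qed

lemma expectation_pot_centered:
  assumes "\<And>j. ess_bounded (g j)" "\<And>j. expectation (g j) = 0"
  shows "expectation (pot g k) = 0"
  unfolding pot_def[abs_def] using assms by (simp add: Bochner_Integration.integral_sum)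

lemma bounded_pot_W [simp]: "ess_bounded (pot W k)" "ess_bounded (pot W1 k)" "ess_bounded (pot W2 k)"
  by (rule W.ess_bounded_pot W1.ess_bounded_pot W2.ess_bounded_pot)+

text \<open>Projections fix constants and the centered parts have potentials of mean zero, so the
  constant can only be the mean of \<open>pot W k\<close>.\<close>

lemma pot_W_eq: "AE x in M. pot W k x = pot W1 k x + pot W2 k x + expectation (pot W k)"
proof -
  define c where "c j = expectation (\<lambda>x. (X j x)\<^sup>2 + 2 * X j x * near K X j x)
    + expectation (\<lambda>x. 2 * X j x * far K X j x)" for j
  have W: "W j = (\<lambda>x. W1 j x + W2 j x + c j)" for j
    by (auto simp: W_def W1_def W2_def c_def H_eq algebra_simps)
  have "AE x in M. \<forall>j\<in>{k<..n}. proj k (W j) x = proj k (W1 j) x + proj k (W2 j) x + c j"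
    unfolding W by (intro AE_finite_allI proj_add3 W1.g_bounded W2.g_bounded) auto
  then have AE: "AE x in M. pot W k x = pot W1 k x + pot W2 k x + (\<Sum>j\<in>{k<..n}. c j)"
    by eventually_elim (simp add: pot_def sum.distrib)
  then have "expectation (pot W k) = expectation (\<lambda>x. pot W1 k x + pot W2 k x + (\<Sum>j\<in>{k<..n}. c j))"
    by (intro integral_cong_AE) (auto simp: ess_bounded_measurable)
  also have "\<dots> = (\<Sum>j\<in>{k<..n}. c j)"
    using expectation_pot_centered[OF W1.g_bounded W1.g_centered]
      expectation_pot_centered[OF W2.g_bounded W2.g_centered] by (simp add: prob_space)
  finally show ?thesis
    using AE by simp
qed

text \<open>The factor \<open>\<bar>X j x\<bar>\<close> is kept rather than replaced by
  \<open>C\<close>, so that the squares sum to a multiple of \<open>A * bsq\<close>.\<close>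

lemma W1_base_le:
  assumes "j \<in> {1..n}"
  shows "AE x in M. \<bar>(X j x)\<^sup>2 + 2 * X j x * near K X j x\<bar> \<le> 3 * (real K * C) * \<bar>X j x\<bar>"
  using X_le[OF assms] near_X_le[of j]
proof eventually_elim
  case (elim x)
  have "1 * C \<le> real K * C"
    using K_ge_1 C_pos by (intro mult_right_mono) auto
  then have "\<bar>X j x + 2 * near K X j x\<bar> \<le> 3 * (real K * C)"
    using elim by linarith
  then have "\<bar>X j x + 2 * near K X j x\<bar> * \<bar>X j x\<bar> \<le> 3 * (real K * C) * \<bar>X j x\<bar>"
    by (rule mult_right_mono) simp
  then show ?case
    by (simp add: power2_eq_square algebra_simps flip: abs_mult)
qed

lemma W1_le:
  assumes "j \<in> {1..n}"
  shows "AE x in M. \<bar>W1 j x\<bar> \<le> 6 * (real K * C\<^sup>2)"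
proof -
  let ?w = "\<lambda>x. (X j x)\<^sup>2 + 2 * X j x * near K X j x"
  have le: "AE x in M. \<bar>?w x\<bar> \<le> 3 * (real K * C\<^sup>2)"
    using W1_base_le[OF assms] X_le[OF assms]
  proof eventually_elim
    case (elim x)
    have "3 * (real K * C) * \<bar>X j x\<bar> \<le> 3 * (real K * C) * C"
      using elim C_pos by (intro mult_left_mono) auto
    with elim show ?case by (simp add: power2_eq_square)
  qed
  have "\<bar>expectation ?w\<bar> \<le> expectation (\<lambda>x. \<bar>?w x\<bar>)"
    by (rule integral_abs_bound)
  also have "\<dots> \<le> expectation (\<lambda>_. 3 * (real K * C\<^sup>2))"
    using le by (intro integral_mono_AE) auto
  also have "\<dots> = 3 * (real K * C\<^sup>2)"
    by (simp add: prob_space)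
  finally have "\<bar>expectation ?w\<bar> \<le> 3 * (real K * C\<^sup>2)" .
  with le show ?thesis
    unfolding W1_def by (rule_tac AE_mp[OF le]) (auto intro!: AE_I2)
qed

text \<open>The window is used twice, once inside \<open>W1\<close> and once for its potential; this
  gives the order \<open>(K * C)\<^sup>2\<close>.\<close>

lemma near_W1_le: "AE x in M. \<bar>near K W1 k x\<bar> \<le> 6 * A"
proof -
  have "AE x in M. \<bar>near K W1 k x\<bar> \<le> real K * (6 * (real K * C\<^sup>2))"
    by (intro W1.near_abs_le W1_le) auto
  then show ?thesis
    by (simp add: A_def power2_eq_square mult_ac)
qed

lemma sum_W1_square_le: "(\<Sum>j\<in>{1..n}. expectation (\<lambda>x. (W1 j x)\<^sup>2)) \<le> 9 * A * bsq"
  unfolding bsq_def sum_distrib_left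
proof (rule sum_mono)
  fix j assume j: "j \<in> {1..n}"
  let ?w = "\<lambda>x. (X j x)\<^sup>2 + 2 * X j x * near K X j x"
  have "expectation (\<lambda>x. (W1 j x)\<^sup>2) \<le> expectation (\<lambda>x. (?w x)\<^sup>2)"
    unfolding W1_def by (rule variance_le) simp
  also have "\<dots> \<le> expectation (\<lambda>x. 9 * A * (X j x)\<^sup>2)"
  proof (rule integral_mono_AE)
    show "AE x in M. (?w x)\<^sup>2 \<le> 9 * A * (X j x)\<^sup>2"
      using W1_base_le[OF j]
    proof eventually_elim
      case (elim x)
      then have "\<bar>?w x\<bar>\<^sup>2 \<le> (3 * (real K * C) * \<bar>X j x\<bar>)\<^sup>2"
        by (rule power_mono) simp
      then show ?case
        by (simp add: power_mult_distrib A_def)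
    qed
  qed auto
  finally show "expectation (\<lambda>x. (W1 j x)\<^sup>2) \<le> 9 * A * expectation (\<lambda>x. (X j x)\<^sup>2)"
    by simp
qed

lemma sum_far_W1_square_le: "(\<Sum>k\<le>n. expectation (\<lambda>x. (far K W1 k x)\<^sup>2)) \<le> 72 * A * v"
proof -
  have "(\<Sum>k\<le>n. expectation (\<lambda>x. (far K W1 k x)\<^sup>2))
      \<le> \<Theta>\<^sup>2 * q ^ K * (\<Sum>j\<in>{1..n}. expectation (\<lambda>x. (W1 j x)\<^sup>2))"
    by (rule W1.sum_far_square_le)
  also have "\<dots> \<le> \<Theta>\<^sup>2 * q ^ K * (9 * A * bsq)"
    using sum_W1_square_le q_pos by (intro mult_left_mono) auto
  also have "\<dots> = 9 * A * (\<Theta>\<^sup>2 * q ^ K * bsq)"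
    by simp
  also have "\<dots> \<le> 9 * A * (8 * v)"
    using tail_square_le A_nonneg by (intro mult_left_mono) auto
  finally show ?thesis by simp
qed

lemma sum_W2_square_le:
  "(\<Sum>j\<in>{1..n}. expectation (\<lambda>x. (W2 j x)\<^sup>2)) \<le> 4 * C\<^sup>2 * (\<Theta>\<^sup>2 * q ^ K * bsq)"
proof -
  have "(\<Sum>j\<in>{1..n}. expectation (\<lambda>x. (W2 j x)\<^sup>2))
      \<le> (\<Sum>j\<in>{1..n}. 4 * C\<^sup>2 * expectation (\<lambda>x. (far K X j x)\<^sup>2))"
  proof (rule sum_mono)
    fix j assume j: "j \<in> {1..n}"
    have "expectation (\<lambda>x. (W2 j x)\<^sup>2) \<le> expectation (\<lambda>x. (2 * X j x * far K X j x)\<^sup>2)"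
      unfolding W2_def by (rule variance_le) simp
    also have "\<dots> \<le> expectation (\<lambda>x. 4 * C\<^sup>2 * (far K X j x)\<^sup>2)"
    proof (rule integral_mono_AE)
      show "AE x in M. (2 * X j x * far K X j x)\<^sup>2 \<le> 4 * C\<^sup>2 * (far K X j x)\<^sup>2"
        using X_le[OF j]
      proof eventually_elim
        case (elim x)
        then have "\<bar>X j x\<bar>\<^sup>2 \<le> C\<^sup>2"
          by (rule power_mono) simp
        then show ?case
          by (simp add: power_mult_distrib mult_right_mono)
      qed
    qed auto
    finally show "expectation (\<lambda>x. (W2 j x)\<^sup>2) \<le> 4 * C\<^sup>2 * expectation (\<lambda>x. (far K X j x)\<^sup>2)"
      by simp
  qed
  also have "\<dots> = 4 * C\<^sup>2 * (\<Sum>j\<in>{1..n}. expectation (\<lambda>x. (far K X j x)\<^sup>2))"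
    by (simp add: sum_distrib_left)
  also have "\<dots> \<le> 4 * C\<^sup>2 * (\<Sum>j\<le>n. expectation (\<lambda>x. (far K X j x)\<^sup>2))"
    by (intro mult_left_mono sum_mono2) auto
  also have "\<dots> \<le> 4 * C\<^sup>2 * (\<Theta>\<^sup>2 * q ^ K * bsq)"
    unfolding bsq_def by (intro mult_left_mono sum_far_square_le) auto
  finally show ?thesis .
qed

text \<open>Smallness is inherited from \<open>far K X\<close>, so the whole potential of
  \<open>W2\<close> is admissible; it costs the second factor
  \<open>\<Theta>\<^sup>2\<close>.\<close>

lemma sum_pot_W2_square_le: "(\<Sum>k\<le>n. expectation (\<lambda>x. (pot W2 k x)\<^sup>2)) \<le> 32 * A * v"
proof -
  have "(\<Sum>k\<le>n. expectation (\<lambda>x. (pot W2 k x)\<^sup>2)) \<le> \<Theta>\<^sup>2 * (4 * C\<^sup>2 * (\<Theta>\<^sup>2 * q ^ K * bsq))"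
    by (rule order_trans[OF W2.sum_pot_square_le]) (intro mult_left_mono sum_W2_square_le, simp)
  also have "\<dots> = C\<^sup>2 * (4 * (\<Theta> ^ 4 * q ^ K * bsq))"
    by (simp add: power2_eq_square power4_eq_xxxx mult_ac)
  also have "\<dots> \<le> A * (4 * (8 * v))"
  proof (rule mult_mono[OF C_square_le _ A_nonneg])
    show "4 * (\<Theta> ^ 4 * q ^ K * bsq) \<le> 4 * (8 * v)"
      using tail_le by linarith
    show "0 \<le> 4 * (\<Theta> ^ 4 * q ^ K * bsq)"
      using tail_nonneg by linarith
  qed
  finally show ?thesis by simp
qed

lemma expectation_H_square_le_A: "expectation (\<lambda>x. (H k x)\<^sup>2) \<le> A"
proof -
  have "expectation (\<lambda>x. (H k x)\<^sup>2) \<le> \<Theta>\<^sup>2 * C\<^sup>2"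
    unfolding H_def using C_pos by (intro expectation_pot_square_le X_le) auto
  also have "\<dots> \<le> (real K)\<^sup>2 * C\<^sup>2"
    using Theta_le_K Theta_ge by (intro mult_right_mono power_mono) auto
  finally show ?thesis by (simp add: A_def power_mult_distrib)
qed

section \<open>Increments of the conditional variance\<close>

lemma expectation_Q_eq: "expectation (Q k) = expectation (pot W k) - expectation (\<lambda>x. (H k x)\<^sup>2)"
  unfolding Q_def[abs_def] by simp

lemma bounded_far_W1 [simp]: "ess_bounded (far K' W1 k)"
  by (rule W1.ess_bounded_far)

text \<open>The mean of \<open>Q k\<close> may be far larger than \<open>A\<close>, so it is kept as
  an exact main term. As \<open>(D k)\<^sup>2 \<ge> 0\<close>, an upper bound for \<open>Q k\<close>
  suffices.\<close>

lemma Q_D_square_le: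
  assumes "k < n"
  shows "expectation (\<lambda>x. Q k x * (D k x)\<^sup>2) \<le> expectation (Q k) * expectation (\<lambda>x. (D k x)\<^sup>2)
    + (7 * A * expectation (\<lambda>x. (D k x)\<^sup>2) + expectation (\<lambda>x. (D k x) ^ 4)
      + expectation (\<lambda>x. (far K W1 k x)\<^sup>2) / 2 + expectation (\<lambda>x. (pot W2 k x)\<^sup>2) / 2)"
proof -
  let ?d2 = "expectation (\<lambda>x. (D k x)\<^sup>2)"
  have "expectation (\<lambda>x. Q k x * (D k x)\<^sup>2)
      \<le> expectation (\<lambda>x. (expectation (Q k) + 7 * A) * (D k x)\<^sup>2 + (D k x) ^ 4
          + (far K W1 k x)\<^sup>2 / 2 + (pot W2 k x)\<^sup>2 / 2)"
  proof (rule integral_mono_AE)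
    show "AE x in M. Q k x * (D k x)\<^sup>2 \<le> (expectation (Q k) + 7 * A) * (D k x)\<^sup>2 + (D k x) ^ 4
          + (far K W1 k x)\<^sup>2 / 2 + (pot W2 k x)\<^sup>2 / 2"
      using pot_W_eq[of k] near_W1_le[of k]
    proof eventually_elim
      case (elim x)
      define d where "d = (D k x)\<^sup>2"
      have "0 \<le> d" by (simp add: d_def)
      \<comment> \<open>\<open>6 * A\<close> is the near part of \<open>W1\<close>; one more
        \<open>A\<close> bounds \<open>E (H k)\<^sup>2\<close>, the difference between the means of
        \<open>pot W k\<close> and \<open>Q k\<close>.\<close>
      have Q: "Q k x \<le> (expectation (Q k) + 7 * A) + far K W1 k x + pot W2 k x"
        using elim expectation_H_square_le_A[of k] zero_le_power2[of "H k x"]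
        unfolding Q_def expectation_Q_eq pot_eq[of W1 k x K] by linarith
      have *: "a * d \<le> a\<^sup>2 / 2 + d\<^sup>2 / 2" for a :: real
        using sum_squares_bound[of a d] by (simp add: field_simps)
      have "Q k x * d \<le> ((expectation (Q k) + 7 * A) + far K W1 k x + pot W2 k x) * d"
        using Q \<open>0 \<le> d\<close> by (rule mult_right_mono)
      also have "\<dots> = (expectation (Q k) + 7 * A) * d + far K W1 k x * d + pot W2 k x * d"
        by (simp add: algebra_simps)
      also have "\<dots> \<le> (expectation (Q k) + 7 * A) * d + d\<^sup>2
          + (far K W1 k x)\<^sup>2 / 2 + (pot W2 k x)\<^sup>2 / 2"
        using *[of "far K W1 k x"] *[of "pot W2 k x"] by simp
      finally show ?case
        by (simp add: d_def)
    qed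
  qed auto
  also have "\<dots> = (expectation (Q k) + 7 * A) * ?d2 + expectation (\<lambda>x. (D k x) ^ 4)
      + expectation (\<lambda>x. (far K W1 k x)\<^sup>2) / 2 + expectation (\<lambda>x. (pot W2 k x)\<^sup>2) / 2"
    by simp
  finally show ?thesis
    by (simp add: algebra_simps)
qed

text \<open>The mixed moment of \<open>Q (Suc k)\<close> and \<open>Q k\<close> is found by testing
  the recursion with \<open>Q k\<close>.\<close>

lemma Q_increment_square:
  assumes "k < n"
  shows "expectation (\<lambda>x. (Q (Suc k) x - Q k x)\<^sup>2) =
    expectation (\<lambda>x. (Q (Suc k) x)\<^sup>2) - expectation (\<lambda>x. (Q k x)\<^sup>2) + 2 * expectation (\<lambda>x. Q k x * (D k x)\<^sup>2)"
proof -
  have "expectation (\<lambda>x. (Q k x)\<^sup>2) = expectation (\<lambda>x. Q k x * Q k x)"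
    by (simp add: power2_eq_square)
  also have "\<dots> = expectation (\<lambda>x. (Q (Suc k) x + (D k x)\<^sup>2) * Q k x)"
    using assms measurable_GF_le[OF measurable_Q] by (intro expectation_Q_mult) auto
  also have "\<dots> = expectation (\<lambda>x. Q (Suc k) x * Q k x) + expectation (\<lambda>x. Q k x * (D k x)\<^sup>2)"
  proof -
    have "(\<lambda>x. (Q (Suc k) x + (D k x)\<^sup>2) * Q k x) = (\<lambda>x. Q (Suc k) x * Q k x + Q k x * (D k x)\<^sup>2)"
      by (simp add: algebra_simps)
    then show ?thesis by simp
  qed
  finally have *: "expectation (\<lambda>x. Q (Suc k) x * Q k x)
      = expectation (\<lambda>x. (Q k x)\<^sup>2) - expectation (\<lambda>x. Q k x * (D k x)\<^sup>2)"
    by simp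
  have "expectation (\<lambda>x. (Q (Suc k) x - Q k x)\<^sup>2)
      = expectation (\<lambda>x. (Q (Suc k) x)\<^sup>2 - 2 * (Q (Suc k) x * Q k x) + (Q k x)\<^sup>2)"
    by (simp add: power2_eq_square algebra_simps)
  also have "\<dots> = expectation (\<lambda>x. (Q (Suc k) x)\<^sup>2) - 2 * expectation (\<lambda>x. Q (Suc k) x * Q k x)
      + expectation (\<lambda>x. (Q k x)\<^sup>2)"
    by simp
  finally show ?thesis
    using * by simp
qed

text \<open>The terms of order \<open>v\<^sup>2\<close> telescope and cancel by Jensen's inequality;
  what remains is of order \<open>A * v\<close>.\<close>

lemma sum_Q_increment_square_le:
  "(\<Sum>k<n. expectation (\<lambda>x. (Q (Suc k) x - Q k x)\<^sup>2)) \<le> 20000 * A * v"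
proof -
  let ?d2 = "\<lambda>k. expectation (\<lambda>x. (D k x)\<^sup>2)" and ?d4 = "\<lambda>k. expectation (\<lambda>x. (D k x) ^ 4)"
    and ?Q2 = "\<lambda>k. expectation (\<lambda>x. (Q k x)\<^sup>2)"
    and ?f = "\<lambda>k. expectation (\<lambda>x. (far K W1 k x)\<^sup>2)" and ?p = "\<lambda>k. expectation (\<lambda>x. (pot W2 k x)\<^sup>2)"
  define e where "e k = expectation (Q k)" for k
  have sq_le: "(expectation f)\<^sup>2 \<le> expectation (\<lambda>x. (f x)\<^sup>2)" if "ess_bounded f" for f
    using expectation_mult_sq_le[of f "\<lambda>_. 1"] that by (simp add: ess_bounded_measurable prob_space)
  have "(\<Sum>k<n. expectation (\<lambda>x. (Q (Suc k) x - Q k x)\<^sup>2))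
      \<le> (\<Sum>k<n. (?Q2 (Suc k) - ?Q2 k) + (e k ^ 2 - e (Suc k) ^ 2) + ?d4 k
          + (14 * A * ?d2 k + 2 * ?d4 k + ?f k + ?p k))"
  proof (rule sum_mono)
    fix k assume "k \<in> {..<n}"
    then have k: "k < n" by simp
    \<comment> \<open>\<open>?d2 k\<close> is the decrement \<open>e k - e (Suc k)\<close>, so this
      is a difference of squares.\<close>
    have "2 * (e k * ?d2 k) = (e k ^ 2 - e (Suc k) ^ 2) + (?d2 k)\<^sup>2"
      unfolding expectation_D_square[OF k] e_def by (simp add: power2_eq_square algebra_simps)
    moreover have "(?d2 k)\<^sup>2 \<le> ?d4 k"
      using sq_le[of "\<lambda>x. (D k x)\<^sup>2"] by simp
    ultimately show "expectation (\<lambda>x. (Q (Suc k) x - Q k x)\<^sup>2)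
        \<le> (?Q2 (Suc k) - ?Q2 k) + (e k ^ 2 - e (Suc k) ^ 2) + ?d4 k
          + (14 * A * ?d2 k + 2 * ?d4 k + ?f k + ?p k)"
      using Q_D_square_le[OF k] Q_increment_square[OF k] unfolding e_def by linarith
  qed
  also have "\<dots> = (\<Sum>k<n. ?Q2 (Suc k) - ?Q2 k) + (\<Sum>k<n. e k ^ 2 - e (Suc k) ^ 2)
      + 3 * (\<Sum>k<n. ?d4 k) + 14 * A * (\<Sum>k<n. ?d2 k) + (\<Sum>k<n. ?f k) + (\<Sum>k<n. ?p k)"
    by (simp add: sum.distrib sum_subtractf sum_distrib_left)
  also have "(\<Sum>k<n. ?Q2 (Suc k) - ?Q2 k) = - ?Q2 0"
    using sum_lessThan_telescope[of ?Q2 n] by simp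
  also have "(\<Sum>k<n. e k ^ 2 - e (Suc k) ^ 2) = e 0 ^ 2"
    using sum_lessThan_telescope'[of "\<lambda>k. e k ^ 2" n] by (simp add: e_def)
  also have "- ?Q2 0 + e 0 ^ 2 + 3 * (\<Sum>k<n. ?d4 k) + 14 * A * (\<Sum>k<n. ?d2 k) + (\<Sum>k<n. ?f k) + (\<Sum>k<n. ?p k)
      \<le> 0 + 3 * (6000 * A * v) + 14 * A * v + 72 * A * v + 32 * A * v"
  proof (intro add_mono mult_left_mono sum_D_fourth_power_le)
    show "- ?Q2 0 + e 0 ^ 2 \<le> 0"
      using sq_le[of "Q 0"] by (simp add: e_def)
    show "(\<Sum>k<n. ?d2 k) \<le> v"
      by (simp add: sum_expectation_D_square)
    show "(\<Sum>k<n. ?f k) \<le> 72 * A * v"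
      using sum_shift_le(2)[of ?f] sum_far_W1_square_le by simp
    show "(\<Sum>k<n. ?p k) \<le> 32 * A * v"
      using sum_shift_le(2)[of ?p] sum_pot_W2_square_le by simp
  qed (use A_nonneg in auto)
  \<comment> \<open>The exact constant is \<open>18000 + 14 + 72 + 32 = 18118\<close>.\<close>
  also have "\<dots> \<le> 20000 * A * v"
    using mult_nonneg_nonneg[OF A_nonneg v_nonneg] by simp
  finally show ?thesis .
qed

end

subsection \<open>Characteristic functions\<close>

text \<open>The intermediate point of the remainder lies between \<open>u\<close> and
  \<open>w\<close>, hence is nonnegative, and its exponential factor is at most one.\<close>

lemma exp_minus_taylor_le:
  fixes u w :: real
  assumes "0 \<le> u" "0 \<le> w"
  shows "\<bar>exp (- w) - exp (- u) * (1 - (w - u))\<bar> \<le> (w - u)\<^sup>2 / 2"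
proof (cases "w = u")
  case False
  have "\<exists>t. (if w < u then w < t \<and> t < u else u < t \<and> t < w) \<and>
      exp (- w) = (\<Sum>m<2. ((- 1) ^ m * exp (- u)) / fact m * (w - u) ^ m)
        + ((- 1) ^ 2 * exp (- t)) / fact 2 * (w - u) ^ 2"
  proof (rule Taylor[where a = 0 and b = "max u w" and diff = "\<lambda>m x. (- 1) ^ m * exp (- x)"])
    show "\<forall>m t. m < 2 \<and> 0 \<le> t \<and> t \<le> max u w \<longrightarrow>
        ((\<lambda>x. (- 1) ^ m * exp (- x)) has_real_derivative (- 1) ^ Suc m * exp (- t)) (at t)"
      by (auto intro!: derivative_eq_intros)
  qed (use assms False in auto)
  then obtain t where t: "if w < u then w < t \<and> t < u else u < t \<and> t < w"
    and eq': "exp (- w) = (\<Sum>m<2. ((- 1) ^ m * exp (- u)) / fact m * (w - u) ^ m)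
        + ((- 1) ^ 2 * exp (- t)) / fact 2 * (w - u) ^ 2"
    by (elim exE conjE)
  have "(\<Sum>m<2. ((- 1) ^ m * exp (- u)) / fact m * (w - u) ^ m) = exp (- u) * (1 - (w - u))"
    by (simp add: numeral_2_eq_2 right_diff_distrib)
  then have eq: "exp (- w) = exp (- u) * (1 - (w - u)) + exp (- t) * ((w - u)\<^sup>2 / 2)"
    using eq' by simp
  have "0 \<le> t"
    using t assms by (auto split: if_splits)
  then have "exp (- t) * ((w - u)\<^sup>2 / 2) \<le> 1 * ((w - u)\<^sup>2 / 2)"
    by (intro mult_right_mono) auto
  moreover have "0 \<le> exp (- t) * ((w - u)\<^sup>2 / 2)"
    by simp
  ultimately show ?thesis
    using eq by linarith
qed simp

text \<open>Since \<open>y\<close> and \<open>y'\<close> are nonnegative, no bound on \<open>y' - y\<close> is needed.\<close>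

lemma iexp_gauss_taylor_le:
  fixes s m d y y' :: real
  assumes "0 \<le> y" "0 \<le> y'"
  shows "cmod (iexp (s * (m + d)) * exp (- (s\<^sup>2 / 2 * y')) - iexp (s * m) * exp (- (s\<^sup>2 / 2 * y))
      - iexp (s * m) * exp (- (s\<^sup>2 / 2 * y)) * (\<i> * (s * d) - s\<^sup>2 / 2 * (d\<^sup>2 + (y' - y))))
    \<le> \<bar>s\<bar> ^ 3 / 6 * \<bar>d\<bar> ^ 3 + \<bar>s\<bar> ^ 3 / 2 * \<bar>d * (y' - y)\<bar> + s ^ 4 / 8 * (y' - y)\<^sup>2"
proof -
  define a where "a = s\<^sup>2 / 2"
  define u u' where "u = exp (- (a * y))" and "u' = exp (- (a * y'))"
  define e where "e = iexp (s * d)"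
  define \<delta> where "\<delta> = y' - y"
  have "0 \<le> a" by (simp add: a_def)
  have u: "0 \<le> u" "u \<le> 1"
    using \<open>0 \<le> a\<close> assms by (auto simp: u_def)
  have "\<bar>u' - u * (1 - (a * y' - a * y))\<bar> \<le> (a * y' - a * y)\<^sup>2 / 2"
    unfolding u_def u'_def using assms \<open>0 \<le> a\<close> by (intro exp_minus_taylor_le) auto
  moreover have "a * y' - a * y = a * \<delta>"
    by (simp add: \<delta>_def right_diff_distrib)
  moreover have "(a * \<delta>)\<^sup>2 / 2 = s ^ 4 / 8 * \<delta>\<^sup>2"
    by (simp add: a_def power_mult_distrib power_divide)
  ultimately have t1: "\<bar>u' - u * (1 - a * \<delta>)\<bar> \<le> s ^ 4 / 8 * \<delta>\<^sup>2"
    by simp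
  have e1: "cmod (e - 1) \<le> \<bar>s\<bar> * \<bar>d\<bar>"
    using iexp_approx1[of "s * d" 0] by (simp add: e_def abs_mult)
  have e2: "cmod (e - 1 - \<i> * (s * d) + s\<^sup>2 / 2 * d\<^sup>2) \<le> \<bar>s\<bar> ^ 3 / 6 * \<bar>d\<bar> ^ 3"
  proof -
    have sum2: "(\<Sum>k\<le>2. z ^ k / fact k) = 1 + z + z\<^sup>2 / 2" for z :: complex
      by (simp add: eval_nat_numeral)
    have sq: "(\<i> * complex_of_real (s * d))\<^sup>2 = - complex_of_real (s\<^sup>2 * d\<^sup>2)"
      by (simp add: power_mult_distrib)
    have "e - 1 - \<i> * (s * d) + s\<^sup>2 / 2 * d\<^sup>2
        = iexp (s * d) - (\<Sum>k\<le>2. (\<i> * complex_of_real (s * d)) ^ k / fact k)"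
      unfolding sum2 sq e_def by simp
    moreover have "\<bar>s * d\<bar> ^ Suc 2 / fact (Suc 2) = \<bar>s\<bar> ^ 3 / 6 * \<bar>d\<bar> ^ 3"
    proof -
      have "fact (Suc 2) = (6 :: real)"
        by (simp add: eval_nat_numeral)
      then show ?thesis
        by (simp add: abs_mult power_mult_distrib)
    qed
    ultimately show ?thesis
      using iexp_approx1[of "s * d" 2] by (simp only:)
  qed
  have exp_add: "iexp (s * (m + d)) = iexp (s * m) * e"
  proof -
    have "\<i> * complex_of_real (s * (m + d)) = \<i> * complex_of_real (s * m) + \<i> * complex_of_real (s * d)"
      by (simp add: algebra_simps)
    then show ?thesis
      by (simp only: e_def exp_add)
  qed
  \<comment> \<open>The first summand is the expansion error of \<open>u'\<close>; in the second,
    the expansion error of \<open>e\<close> and the mixed term \<open>a * \<delta> * (e - 1)\<close>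
    remain.\<close>
  have "iexp (s * (m + d)) * u' - iexp (s * m) * u
      - iexp (s * m) * u * (\<i> * (s * d) - a * (d\<^sup>2 + (y' - y)))
    = iexp (s * m) * (e * (u' - u * (1 - a * \<delta>))
        + u * ((e - 1 - \<i> * (s * d) + a * d\<^sup>2) - a * \<delta> * (e - 1)))"
    unfolding exp_add \<delta>_def[symmetric] by (simp add: algebra_simps)
  also have "cmod \<dots> = cmod (e * (u' - u * (1 - a * \<delta>))
        + u * ((e - 1 - \<i> * (s * d) + a * d\<^sup>2) - a * \<delta> * (e - 1)))"
    by (simp add: norm_mult)
  also have "\<dots> \<le> cmod (e * (u' - u * (1 - a * \<delta>)))
      + cmod (u * ((e - 1 - \<i> * (s * d) + a * d\<^sup>2) - a * \<delta> * (e - 1)))"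
    by (rule norm_triangle_ineq)
  also have "cmod (e * (u' - u * (1 - a * \<delta>))) = \<bar>u' - u * (1 - a * \<delta>)\<bar>"
    by (simp add: norm_mult e_def del: of_real_diff of_real_mult)
  also have "cmod (u * ((e - 1 - \<i> * (s * d) + a * d\<^sup>2) - a * \<delta> * (e - 1)))
      \<le> 1 * (cmod (e - 1 - \<i> * (s * d) + a * d\<^sup>2) + cmod (a * \<delta> * (e - 1)))"
    by (subst norm_mult, intro mult_mono norm_triangle_ineq4) (use u in auto)
  also have "cmod (a * \<delta> * (e - 1)) \<le> \<bar>a * \<delta>\<bar> * (\<bar>s\<bar> * \<bar>d\<bar>)"
  proof -
    have "cmod (a * \<delta> * (e - 1)) = \<bar>a * \<delta>\<bar> * cmod (e - 1)"
      by (simp add: norm_mult abs_mult)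
    then show ?thesis
      using mult_left_mono[OF e1, of "\<bar>a * \<delta>\<bar>"] by simp
  qed
  also have "\<bar>a * \<delta>\<bar> * (\<bar>s\<bar> * \<bar>d\<bar>) = \<bar>s\<bar> ^ 3 / 2 * \<bar>d * \<delta>\<bar>"
    by (simp add: a_def abs_mult power2_eq_square power3_eq_cube)
  finally have "cmod (iexp (s * (m + d)) * u' - iexp (s * m) * u
      - iexp (s * m) * u * (\<i> * (s * d) - a * (d\<^sup>2 + (y' - y))))
    \<le> s ^ 4 / 8 * \<delta>\<^sup>2 + (\<bar>s\<bar> ^ 3 / 6 * \<bar>d\<bar> ^ 3 + \<bar>s\<bar> ^ 3 / 2 * \<bar>d * \<delta>\<bar>)"
    using t1 e2 by (simp add: a_def)
  then show ?thesis
    by (simp add: u_def u'_def a_def \<delta>_def)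
qed

section \<open>The interpolating exponential and its one-step errors\<close>

context mixing_chain_window
begin

definition \<Psi> :: "real \<Rightarrow> nat \<Rightarrow> 'a \<Rightarrow> complex" where
  "\<Psi> s k x = iexp (s * (S k x + H k x)) * exp (- (s\<^sup>2 / 2 * Q k x))"

lemma measurable_Psi [measurable]: "\<Psi> s k \<in> borel_measurable M"
proof -
  note [measurable] = ess_bounded_measurable[OF bounded_S[of k]] ess_bounded_measurable[OF bounded_H[of k]]
    ess_bounded_measurable[OF bounded_Q[of k]]
  show ?thesis
    unfolding \<Psi>_def[abs_def] by measurable
qed

lemma integrable_Psi:
  assumes "k \<le> n"
  shows "integrable M (\<Psi> s k)"
proof (rule integrable_const_bound)
  show "AE x in M. cmod (\<Psi> s k x) \<le> 1"
    using Q_nonneg[OF assms] by eventually_elim (simp add: \<Psi>_def norm_mult)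
qed simp

text \<open>Real and imaginary part of \<open>\<Psi> s k\<close> are bounded functions
  \<open>c\<close>, \<open>d\<close> of the past, hence valid test functions for the two recursions
  of \<open>D\<close> and \<open>Q\<close>.\<close>

lemma expectation_Psi_linear:
  assumes "k < n"
  shows "integrable M (\<lambda>x. \<Psi> s k x * (\<i> * (s * D k x) - s\<^sup>2 / 2 * ((D k x)\<^sup>2 + (Q (Suc k) x - Q k x))))"
    and "(\<integral>x. \<Psi> s k x * (\<i> * (s * D k x) - s\<^sup>2 / 2 * ((D k x)\<^sup>2 + (Q (Suc k) x - Q k x))) \<partial>M) = 0"
proof -
  define c where "c x = cos (s * (S k x + H k x)) * exp (- (s\<^sup>2 / 2 * Q k x))" for x
  define d where "d x = sin (s * (S k x + H k x)) * exp (- (s\<^sup>2 / 2 * Q k x))" for x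
  define P where "P x = (D k x)\<^sup>2 + (Q (Suc k) x - Q k x)" for x
  have meas: "c \<in> borel_measurable (F k)" "d \<in> borel_measurable (F k)"
    using measurable_S[of k] measurable_GF_le[OF measurable_H[of k]] measurable_GF_le[OF measurable_Q[of k]]
    unfolding c_def[abs_def] d_def[abs_def] by measurable
  have le: "\<bar>a * exp (- (s\<^sup>2 / 2 * y))\<bar> \<le> 1" if "\<bar>a\<bar> \<le> 1" "0 \<le> y" for a y :: real
    unfolding abs_mult using that by (intro mult_le_one) auto
  have bdd: "ess_bounded c" "ess_bounded d"
  proof -
    have Q: "AE x in M. 0 \<le> Q k x"
      using assms by (intro Q_nonneg) simp
    have "AE x in M. \<bar>c x\<bar> \<le> 1"
      using Q unfolding c_def by eventually_elim (intro le, auto)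
    moreover have "AE x in M. \<bar>d x\<bar> \<le> 1"
      using Q unfolding d_def by eventually_elim (intro le, auto)
    ultimately show "ess_bounded c" "ess_bounded d"
      using meas[THEN measurable_FM] by (auto intro: ess_boundedI)
  qed
  have [simp]: "ess_bounded P"
    unfolding P_def[abs_def] by simp
  have D0: "expectation (\<lambda>x. D k x * c x) = 0" "expectation (\<lambda>x. D k x * d x) = 0"
    using assms meas bdd by (auto intro: expectation_D_mult)
  have P_eq: "expectation (\<lambda>x. P x * \<psi> x) = 0"
    if "\<psi> \<in> borel_measurable (F k)" and [simp]: "ess_bounded \<psi>" for \<psi>
  proof -
    have "(\<lambda>x. P x * \<psi> x) = (\<lambda>x. (Q (Suc k) x + (D k x)\<^sup>2) * \<psi> x - Q k x * \<psi> x)"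
      by (auto simp: P_def algebra_simps)
    then show ?thesis
      using expectation_Q_mult[OF assms that] by simp
  qed
  have P0: "expectation (\<lambda>x. P x * c x) = 0" "expectation (\<lambda>x. P x * d x) = 0"
    using meas bdd by (auto intro: P_eq)
  define f where "f x = - s * (D k x * d x) - s\<^sup>2 / 2 * (P x * c x)" for x
  define g where "g x = s * (D k x * c x) - s\<^sup>2 / 2 * (P x * d x)" for x
  have f: "integrable M f" "expectation f = 0" and g: "integrable M g" "expectation g = 0"
    using bdd D0 P0 unfolding f_def[abs_def] g_def[abs_def] by simp_all
  have eq: "\<Psi> s k x * (\<i> * (s * D k x) - s\<^sup>2 / 2 * ((D k x)\<^sup>2 + (Q (Suc k) x - Q k x)))
      = complex_of_real (f x) + \<i> * complex_of_real (g x)" for x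
  proof -
    have euler: "iexp \<theta> = complex_of_real (cos \<theta>) + \<i> * complex_of_real (sin \<theta>)" for \<theta>
      by (simp add: exp_Euler cos_of_real sin_of_real)
    have "\<Psi> s k x = complex_of_real (c x) + \<i> * complex_of_real (d x)"
      unfolding \<Psi>_def c_def d_def euler by (simp only: of_real_mult distrib_right mult.assoc)
    then show ?thesis
      by (simp add: f_def g_def P_def complex_eq_iff algebra_simps)
  qed
  show "integrable M (\<lambda>x. \<Psi> s k x * (\<i> * (s * D k x) - s\<^sup>2 / 2 * ((D k x)\<^sup>2 + (Q (Suc k) x - Q k x))))"
    unfolding eq using f g by simp
  show "(\<integral>x. \<Psi> s k x * (\<i> * (s * D k x) - s\<^sup>2 / 2 * ((D k x)\<^sup>2 + (Q (Suc k) x - Q k x))) \<partial>M) = 0"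
    unfolding eq using f g by simp
qed

lemma Psi_step_le:
  assumes "0 \<le> Q k x" "0 \<le> Q (Suc k) x"
  shows "cmod (\<Psi> s (Suc k) x - \<Psi> s k x
      - \<Psi> s k x * (\<i> * (s * D k x) - s\<^sup>2 / 2 * ((D k x)\<^sup>2 + (Q (Suc k) x - Q k x))))
    \<le> \<bar>s\<bar> ^ 3 / 6 * \<bar>D k x\<bar> ^ 3 + \<bar>s\<bar> ^ 3 / 2 * \<bar>D k x * (Q (Suc k) x - Q k x)\<bar>
      + s ^ 4 / 8 * (Q (Suc k) x - Q k x)\<^sup>2"
  unfolding \<Psi>_def S_plus_H_Suc by (rule iexp_gauss_taylor_le[OF assms])

lemma expectation_Psi_step_le:
  assumes "k < n"
  shows "cmod ((\<integral>x. \<Psi> s (Suc k) x \<partial>M) - (\<integral>x. \<Psi> s k x \<partial>M))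
    \<le> \<bar>s\<bar> ^ 3 / 6 * expectation (\<lambda>x. \<bar>D k x\<bar> ^ 3)
      + \<bar>s\<bar> ^ 3 / 2 * expectation (\<lambda>x. \<bar>D k x * (Q (Suc k) x - Q k x)\<bar>)
      + s ^ 4 / 8 * expectation (\<lambda>x. (Q (Suc k) x - Q k x)\<^sup>2)"
proof -
  let ?L = "\<lambda>x. \<Psi> s k x * (\<i> * (s * D k x) - s\<^sup>2 / 2 * ((D k x)\<^sup>2 + (Q (Suc k) x - Q k x)))"
  let ?r = "\<lambda>x. \<bar>s\<bar> ^ 3 / 6 * \<bar>D k x\<bar> ^ 3 + \<bar>s\<bar> ^ 3 / 2 * \<bar>D k x * (Q (Suc k) x - Q k x)\<bar>
    + s ^ 4 / 8 * (Q (Suc k) x - Q k x)\<^sup>2"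
  have i: "integrable M (\<Psi> s (Suc k))" "integrable M (\<Psi> s k)"
    using assms by (auto intro: integrable_Psi)
  note i = i expectation_Psi_linear(1)[OF assms, of s]
  have "cmod ((\<integral>x. \<Psi> s (Suc k) x \<partial>M) - (\<integral>x. \<Psi> s k x \<partial>M))
      = cmod (\<integral>x. \<Psi> s (Suc k) x - \<Psi> s k x - ?L x \<partial>M)"
    using i expectation_Psi_linear(2)[OF assms, of s] by simp
  also have "\<dots> \<le> (\<integral>x. cmod (\<Psi> s (Suc k) x - \<Psi> s k x - ?L x) \<partial>M)"
    by (rule integral_norm_bound)
  also have "\<dots> \<le> (\<integral>x. ?r x \<partial>M)"
  proof (rule integral_mono_AE)
    show "AE x in M. cmod (\<Psi> s (Suc k) x - \<Psi> s k x - ?L x) \<le> ?r x"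
      using Q_nonneg[OF less_imp_le[OF assms]] Q_nonneg[OF Suc_leI[OF assms]]
      by eventually_elim (rule Psi_step_le)
    show "integrable M (\<lambda>x. cmod (\<Psi> s (Suc k) x - \<Psi> s k x - ?L x))"
      by (intro integrable_norm Bochner_Integration.integrable_diff i)
  qed simp
  also have "\<dots> = \<bar>s\<bar> ^ 3 / 6 * expectation (\<lambda>x. \<bar>D k x\<bar> ^ 3)
      + \<bar>s\<bar> ^ 3 / 2 * expectation (\<lambda>x. \<bar>D k x * (Q (Suc k) x - Q k x)\<bar>)
      + s ^ 4 / 8 * expectation (\<lambda>x. (Q (Suc k) x - Q k x)\<^sup>2)"
    by simp
  finally show ?thesis .
qed

lemma char_S_approx:
  fixes s :: real
  defines "\<kappa> \<equiv> real K * C"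
  shows "cmod ((\<integral>x. iexp (s * S n x) \<partial>M) - exp (- (s\<^sup>2 / 2 * v)))
    \<le> 6000 * \<bar>s\<bar> ^ 3 * \<kappa> * v + 2500 * s ^ 4 * \<kappa>\<^sup>2 * v"
proof -
  let ?d2 = "\<lambda>k. expectation (\<lambda>x. (D k x)\<^sup>2)" and ?d4 = "\<lambda>k. expectation (\<lambda>x. (D k x) ^ 4)"
    and ?q = "\<lambda>k. expectation (\<lambda>x. (Q (Suc k) x - Q k x)\<^sup>2)"
  have "0 < \<kappa>"
    using K_ge_1 C_pos by (simp add: \<kappa>_def)
  have A: "A = \<kappa>\<^sup>2"
    by (simp add: A_def \<kappa>_def)
  have "(\<integral>x. \<Psi> s n x \<partial>M) = (\<integral>x. iexp (s * S n x) \<partial>M)"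
    by (simp add: \<Psi>_def)
  moreover have "(\<integral>x. \<Psi> s 0 x \<partial>M) = exp (- (s\<^sup>2 / 2 * v))"
  proof -
    have "(\<integral>x. \<Psi> s 0 x \<partial>M) = (\<integral>x. complex_of_real (exp (- (s\<^sup>2 / 2 * v))) \<partial>M)"
    proof (rule integral_cong_AE)
      show "AE x in M. \<Psi> s 0 x = complex_of_real (exp (- (s\<^sup>2 / 2 * v)))"
        using H_0 Q_0 by eventually_elim (simp add: \<Psi>_def S_def)
    qed auto
    then show ?thesis by (simp add: prob_space)
  qed
  ultimately have "cmod ((\<integral>x. iexp (s * S n x) \<partial>M) - exp (- (s\<^sup>2 / 2 * v)))
      = cmod (\<Sum>k<n. (\<integral>x. \<Psi> s (Suc k) x \<partial>M) - (\<integral>x. \<Psi> s k x \<partial>M))"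
    by (simp add: sum_lessThan_telescope[of "\<lambda>k. \<integral>x. \<Psi> s k x \<partial>M"])
  \<comment> \<open>With weight \<open>\<kappa>\<close> both halves of each mean sum to order
    \<open>\<kappa> * v\<close>, because \<open>?d4\<close> and \<open>?q\<close> sum to order
    \<open>\<kappa>\<^sup>2 * v\<close>.\<close>
  also have "\<dots> \<le> (\<Sum>k<n. \<bar>s\<bar> ^ 3 / 6 * ((\<kappa> * ?d2 k + ?d4 k / \<kappa>) / 2)
      + \<bar>s\<bar> ^ 3 / 2 * ((\<kappa> * ?d2 k + ?q k / \<kappa>) / 2) + s ^ 4 / 8 * ?q k)"
  proof (intro sum_norm_le)
    fix k assume "k \<in> {..<n}"
    have "expectation (\<lambda>x. \<bar>D k x\<bar> ^ 3) \<le> expectation (\<lambda>x. (\<kappa> * (D k x)\<^sup>2 + (D k x) ^ 4 / \<kappa>) / 2)"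
    proof (rule integral_mono)
      fix x
      show "\<bar>D k x\<bar> ^ 3 \<le> (\<kappa> * (D k x)\<^sup>2 + (D k x) ^ 4 / \<kappa>) / 2"
      proof -
        have "\<bar>D k x\<bar> ^ 3 = \<bar>D k x * (D k x)\<^sup>2\<bar>"
          by (simp add: abs_mult power3_eq_cube power2_eq_square)
        then show ?thesis
          using abs_mult_le_weighted[OF \<open>0 < \<kappa>\<close>, of "D k x" "(D k x)\<^sup>2"] by simp
      qed
    qed auto
    also have "\<dots> = (\<kappa> * ?d2 k + ?d4 k / \<kappa>) / 2"
      by simp
    finally have le3: "expectation (\<lambda>x. \<bar>D k x\<bar> ^ 3) \<le> (\<kappa> * ?d2 k + ?d4 k / \<kappa>) / 2" .
    have "expectation (\<lambda>x. \<bar>D k x * (Q (Suc k) x - Q k x)\<bar>)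
        \<le> expectation (\<lambda>x. (\<kappa> * (D k x)\<^sup>2 + (Q (Suc k) x - Q k x)\<^sup>2 / \<kappa>) / 2)"
      by (intro integral_mono abs_mult_le_weighted \<open>0 < \<kappa>\<close>) auto
    also have "\<dots> = (\<kappa> * ?d2 k + ?q k / \<kappa>) / 2"
      by simp
    finally have leq: "expectation (\<lambda>x. \<bar>D k x * (Q (Suc k) x - Q k x)\<bar>) \<le> (\<kappa> * ?d2 k + ?q k / \<kappa>) / 2" .
    have "\<bar>s\<bar> ^ 3 / 6 * expectation (\<lambda>x. \<bar>D k x\<bar> ^ 3) \<le> \<bar>s\<bar> ^ 3 / 6 * ((\<kappa> * ?d2 k + ?d4 k / \<kappa>) / 2)"
      by (rule mult_left_mono[OF le3]) simp
    moreover have "\<bar>s\<bar> ^ 3 / 2 * expectation (\<lambda>x. \<bar>D k x * (Q (Suc k) x - Q k x)\<bar>)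
        \<le> \<bar>s\<bar> ^ 3 / 2 * ((\<kappa> * ?d2 k + ?q k / \<kappa>) / 2)"
      by (rule mult_left_mono[OF leq]) simp
    ultimately show "cmod ((\<integral>x. \<Psi> s (Suc k) x \<partial>M) - (\<integral>x. \<Psi> s k x \<partial>M))
        \<le> \<bar>s\<bar> ^ 3 / 6 * ((\<kappa> * ?d2 k + ?d4 k / \<kappa>) / 2)
          + \<bar>s\<bar> ^ 3 / 2 * ((\<kappa> * ?d2 k + ?q k / \<kappa>) / 2) + s ^ 4 / 8 * ?q k"
      using expectation_Psi_step_le[of k s] \<open>k \<in> {..<n}\<close> unfolding lessThan_iff by linarith
  qed
  also have "\<dots> = \<bar>s\<bar> ^ 3 / 6 * ((\<kappa> * (\<Sum>k<n. ?d2 k) + (\<Sum>k<n. ?d4 k) / \<kappa>) / 2)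
      + \<bar>s\<bar> ^ 3 / 2 * ((\<kappa> * (\<Sum>k<n. ?d2 k) + (\<Sum>k<n. ?q k) / \<kappa>) / 2) + s ^ 4 / 8 * (\<Sum>k<n. ?q k)"
    by (simp add: sum.distrib flip: sum_distrib_left sum_divide_distrib)
  also have "\<dots> \<le> \<bar>s\<bar> ^ 3 / 6 * ((\<kappa> * v + (6000 * A * v) / \<kappa>) / 2)
      + \<bar>s\<bar> ^ 3 / 2 * ((\<kappa> * v + (20000 * A * v) / \<kappa>) / 2) + s ^ 4 / 8 * (20000 * A * v)"
    using sum_D_fourth_power_le sum_Q_increment_square_le \<open>0 < \<kappa>\<close>
    unfolding sum_expectation_D_square
    by (intro add_mono mult_left_mono divide_right_mono) auto
  also have "\<dots> = (6001 / 12 + 20001 / 4) * (\<bar>s\<bar> ^ 3 * \<kappa> * v) + 2500 * s ^ 4 * \<kappa>\<^sup>2 * v"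
    using \<open>0 < \<kappa>\<close> by (simp add: A power2_eq_square field_simps)
  also have "\<dots> \<le> 6000 * (\<bar>s\<bar> ^ 3 * \<kappa> * v) + 2500 * s ^ 4 * \<kappa>\<^sup>2 * v"
    using \<open>0 < \<kappa>\<close> v_nonneg by (intro add_mono mult_right_mono) auto
  finally show ?thesis by (simp add: mult.assoc)
qed

end

subsection \<open>Markov chains with maximal correlation\<close>

context prob_space
begin

text \<open>
  The conclusion is the orthogonality of \<open>f\<close> and \<open>p = 1\<^sub>A - E (1\<^sub>A | R)\<close> for \<open>A\<close> in \<open>P\<close>, that is
  \<open>E (p | T) = 0\<close>, which involves only indicators.
\<close>

lemma cond_exp_markov_extend:
  assumes P: "subalgebra M P" and R: "subalgebra P R" and T: "subalgebra M T"
    and ind: "\<And>A. A \<in> sets T \<Longrightarrow>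
      AE x in M. real_cond_exp M P (indicator A) x = real_cond_exp M R (indicator A) x"
    and f: "f \<in> borel_measurable T" "ess_bounded f"
  shows "AE x in M. real_cond_exp M P f x = real_cond_exp M R f x"
proof -
  interpret P: sigma_finite_subalgebra M P by (rule sigma_finite_subalg) fact
  interpret T: sigma_finite_subalgebra M T by (rule sigma_finite_subalg) fact
  have MR: "subalgebra M R"
    using P R by (auto simp: subalgebra_def)
  have R_P: "real_cond_exp M R g \<in> borel_measurable P" for g
    by (rule measurable_from_subalg[OF R]) simp
  have R_M: "real_cond_exp M R g \<in> borel_measurable M" for g
    by (rule measurable_from_subalg[OF MR]) simp
  have bR [simp]: "ess_bounded (real_cond_exp M R g)" if "ess_bounded g" for g
    using ess_bounded_cond_exp[OF MR that] .
  \<comment> \<open>Conditioning on \<open>R\<close> is self-adjoint.\<close>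
  have swap: "expectation (\<lambda>x. g x * real_cond_exp M R h x) = expectation (\<lambda>x. real_cond_exp M R g x * h x)"
    if "ess_bounded g" "ess_bounded h" for g h
  proof -
    have "expectation (\<lambda>x. g x * real_cond_exp M R h x)
        = expectation (\<lambda>x. real_cond_exp M R g x * real_cond_exp M R h x)"
      using that by (intro expectation_cond_exp_mult[symmetric] MR) auto
    also have "\<dots> = expectation (\<lambda>x. real_cond_exp M R h x * real_cond_exp M R g x)"
      by (simp add: mult.commute)
    also have "\<dots> = expectation (\<lambda>x. h x * real_cond_exp M R g x)"
      using that by (intro expectation_cond_exp_mult MR) auto
    finally show ?thesis
      by (simp add: mult.commute)
  qed
  show ?thesis
  proof (rule P.real_cond_exp_charact)
    fix A assume A: "A \<in> sets P"
    then have AM: "A \<in> sets M"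
      using P by (auto simp: subalgebra_def)
    define p where "p x = indicator A x - real_cond_exp M R (indicator A) x" for x
    have p: "ess_bounded p"
      unfolding p_def[abs_def] using AM by simp
    have "AE x in M. real_cond_exp M T p x = 0"
    proof (rule T.real_cond_exp_charact)
      fix B assume B: "B \<in> sets T"
      then have BM: "B \<in> sets M"
        using T by (auto simp: subalgebra_def)
      have "expectation (\<lambda>x. indicator B x * real_cond_exp M R (indicator A) x)
          = expectation (\<lambda>x. real_cond_exp M R (indicator B) x * indicator A x)"
        using AM BM by (intro swap) auto
      also have "\<dots> = expectation (\<lambda>x. real_cond_exp M P (indicator B) x * indicator A x)"
        using ind[OF B] AM R_M by (intro integral_cong_AE) auto
      also have "\<dots> = expectation (\<lambda>x. indicator B x * indicator A x)"
        using A AM BM by (intro expectation_cond_exp_mult P) auto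
      finally have "expectation (\<lambda>x. indicator B x * p x) = 0"
        using AM BM by (simp add: p_def right_diff_distrib)
      then show "(\<integral>x\<in>B. p x \<partial>M) = (\<integral>x\<in>B. 0 \<partial>M)"
        by (simp add: set_lebesgue_integral_def)
    qed (use p in auto)
    then have "expectation (\<lambda>x. real_cond_exp M T p x * f x) = expectation (\<lambda>_. 0)"
      using f by (intro integral_cong_AE) (auto simp: ess_bounded_measurable)
    then have "expectation (\<lambda>x. p x * f x) = 0"
      using expectation_cond_exp_mult[OF T p f(2,1)] by simp
    moreover have "(\<lambda>x. p x * f x) =
        (\<lambda>x. f x * indicator A x - f x * real_cond_exp M R (indicator A) x)"
      by (auto simp: p_def algebra_simps)
    ultimately have "expectation (\<lambda>x. f x * indicator A x)
        = expectation (\<lambda>x. f x * real_cond_exp M R (indicator A) x)"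
      using f AM by simp
    also have "\<dots> = expectation (\<lambda>x. real_cond_exp M R f x * indicator A x)"
      using f AM by (intro swap) auto
    finally show "(\<integral>x\<in>A. f x \<partial>M) = (\<integral>x\<in>A. real_cond_exp M R f x \<partial>M)"
      by (simp add: set_lebesgue_integral_def mult.commute)
  qed (use f R_P in auto)
qed

lemma centered_L2:
  fixes f :: "'a \<Rightarrow> real"
  assumes "f \<in> borel_measurable M" "integrable M (\<lambda>x. (f x)\<^sup>2)"
  shows "(\<lambda>x. f x - c) \<in> borel_measurable M" "integrable M (\<lambda>x. (f x - c)\<^sup>2)"
proof -
  show "(\<lambda>x. f x - c) \<in> borel_measurable M"
    using assms by simp
  have "integrable M f"
    using integrable_mult_L2[of f "\<lambda>_. 1"] assms by simp
  moreover have "(\<lambda>x. (f x - c)\<^sup>2) = (\<lambda>x. (f x)\<^sup>2 - 2 * c * f x + c\<^sup>2)"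
    by (auto simp: power2_eq_square algebra_simps)
  ultimately show "integrable M (\<lambda>x. (f x - c)\<^sup>2)"
    using assms by simp
qed

text \<open>This makes the set in \<open>max_corr\<close> bounded, so that its real supremum is an
  upper bound.\<close>

lemma abs_corr_le_1:
  assumes "f \<in> borel_measurable M" "integrable M (\<lambda>x. (f x)\<^sup>2)"
    and "g \<in> borel_measurable M" "integrable M (\<lambda>x. (g x)\<^sup>2)"
  shows "\<bar>corr M f g\<bar> \<le> 1"
proof -
  have abs_quotient_le: "\<bar>c / d\<bar> \<le> 1" if "\<bar>c\<bar> \<le> d" "0 \<le> d" for c d :: real
    using that by (cases "d = 0") auto
  have "(covariance M f g)\<^sup>2 \<le> variance f * variance g"
    unfolding covariance_def using assms by (intro expectation_mult_sq_le centered_L2)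
  then have "\<bar>covariance M f g\<bar> \<le> sqrt (variance f) * sqrt (variance g)"
    by (simp add: real_le_rsqrt flip: real_sqrt_mult)
  moreover have "0 \<le> sqrt (variance f) * sqrt (variance g)"
    by simp
  ultimately show ?thesis
    unfolding corr_def by (rule abs_quotient_le)
qed

lemma abs_corr_le_max_corr:
  assumes A: "subalgebra M A" and B: "subalgebra M B" and f: "f \<in> L2 M A" and g: "g \<in> L2 M B"
  shows "\<bar>corr M f g\<bar> \<le> max_corr M A B"
proof -
  have "\<bar>corr M f g\<bar> \<le> 1" if "f \<in> L2 M A" "g \<in> L2 M B" for f g
    using that measurable_from_subalg[OF A] measurable_from_subalg[OF B]
    by (intro abs_corr_le_1) (auto simp: L2_def)
  then have "bdd_above ((\<lambda>(f, g). \<bar>corr M f g\<bar>) ` (L2 M A \<times> L2 M B))"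
    by (intro bdd_aboveI[of _ 1]) auto
  from cSUP_upper[OF _ this, of "(f, g)"] show ?thesis
    using f g by (simp add: max_corr_def)
qed

lemma max_corr_nonneg:
  assumes "subalgebra M A" "subalgebra M B"
  shows "0 \<le> max_corr M A B"
proof -
  have "0 \<le> \<bar>corr M (\<lambda>_. 0) (\<lambda>_. 0)\<bar>"
    by simp
  also have "\<dots> \<le> max_corr M A B"
    using assms by (intro abs_corr_le_max_corr) (auto simp: L2_def)
  finally show ?thesis .
qed

text \<open>Duality: \<open>g = E (f | A)\<close> satisfies \<open>E g\<^sup>2 = E (f * g)\<close>,
  which is at most \<open>max_corr\<close> times both \<open>L2\<close> norms; the norm of
  \<open>g\<close> cancels.\<close>

lemma cond_exp_square_le_max_corr:
  assumes A: "subalgebra M A" and B: "subalgebra M B"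
    and f: "f \<in> borel_measurable B" "ess_bounded f" "expectation f = 0"
  shows "expectation (\<lambda>x. (real_cond_exp M A f x)\<^sup>2) \<le> (max_corr M A B)\<^sup>2 * expectation (\<lambda>x. (f x)\<^sup>2)"
proof -
  define g where "g = real_cond_exp M A f"
  define a b where "a = expectation (\<lambda>x. (g x)\<^sup>2)" and "b = expectation (\<lambda>x. (f x)\<^sup>2)"
  have g: "g \<in> borel_measurable A" "ess_bounded g"
    using ess_bounded_cond_exp[OF A f(2)] by (auto simp: g_def)
  have eg: "expectation g = 0"
    using expectation_cond_exp_mult[OF A f(2), of "\<lambda>_. 1"] f(3) by (simp add: g_def)
  have "a = expectation (\<lambda>x. real_cond_exp M A f x * g x)"
    by (simp add: a_def g_def power2_eq_square)
  also have "\<dots> = expectation (\<lambda>x. f x * g x)"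
    by (rule expectation_cond_exp_mult[OF A f(2) g(2,1)])
  finally have a_eq: "a = covariance M g f"
    by (simp add: covariance_def eg f(3) mult.commute)
  have nonneg: "0 \<le> a" "0 \<le> b"
    by (auto simp: a_def b_def)
  \<comment> \<open>This survives a vanishing variance, where \<open>corr\<close> is
    \<open>0\<close>, because Cauchy--Schwarz then forces \<open>a = 0\<close>.\<close>
  have "a = corr M g f * (sqrt a * sqrt b)"
  proof (cases "a = 0 \<or> b = 0")
    case True
    have "(expectation (\<lambda>x. g x * f x))\<^sup>2 \<le> a * b"
      unfolding a_def b_def using f g
      by (intro expectation_mult_sq_le) (auto simp: ess_bounded_measurable)
    moreover have "expectation (\<lambda>x. g x * f x) = a"
      by (simp add: a_eq covariance_def eg f(3))
    ultimately have "a\<^sup>2 \<le> a * b"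
      by simp
    then have "a = 0"
      using True by auto
    then show ?thesis by simp
  next
    case False
    have "corr M g f = a / (sqrt a * sqrt b)"
      by (simp add: corr_def eg f(3) a_eq[symmetric]) (simp add: a_def b_def)
    then show ?thesis
      using False by simp
  qed
  also have "\<dots> \<le> max_corr M A B * (sqrt a * sqrt b)"
  proof (rule mult_right_mono)
    have "\<bar>corr M g f\<bar> \<le> max_corr M A B"
      using f g by (intro abs_corr_le_max_corr A B) (auto simp: L2_def)
    then show "corr M g f \<le> max_corr M A B" by simp
  qed (use nonneg in simp)
  finally have le: "sqrt a * sqrt a \<le> (max_corr M A B * sqrt b) * sqrt a"
    using nonneg by (simp add: mult_ac)
  have "sqrt a \<le> max_corr M A B * sqrt b"
  proof (cases "a = 0")
    case True
    then show ?thesis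
      using nonneg max_corr_nonneg[OF A B] by simp
  next
    case False
    then show ?thesis
      using mult_right_le_imp_le[OF le] nonneg by simp
  qed
  then have "(sqrt a)\<^sup>2 \<le> (max_corr M A B * sqrt b)\<^sup>2"
    using nonneg by (intro power_mono) auto
  then show ?thesis
    using nonneg by (simp add: power_mult_distrib a_def b_def g_def)
qed

end

section \<open>Sigma-algebras of the past and of the present\<close>

lemma space_sigma_past [simp]: "space (sigma_past M N \<xi> i) = space M"
  by (simp add: sigma_past_def)

lemma space_sigma_gen [simp]: "space (sigma_gen M N Y) = space M"
  by (simp add: sigma_gen_def)

text \<open>Over the empty index set the tuple map is constant; thus time \<open>0\<close> carries
  no information.\<close>

lemma sets_sigma_past_0: "sets (sigma_past M N \<xi> 0) = {{}, space M}"
proof -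
  have "sets (sigma_past M N \<xi> 0) =
      {(\<lambda>\<omega>. \<lambda>j\<in>{1..0}. \<xi> j \<omega>) -` A \<inter> space M | A. A \<in> sets (\<Pi>\<^sub>M j\<in>{1..0}. N)}"
    unfolding sigma_past_def by (rule sets_vimage_algebra2) (auto simp: space_PiM)
  also have "\<dots> = {{}, space M}"
  proof -
    have "(\<lambda>\<omega>. \<lambda>j\<in>{1..0}. \<xi> j \<omega>) = (\<lambda>_ _. undefined)"
      by (auto simp: restrict_def)
    then show ?thesis
      by (auto simp: sets_PiM_empty conj_disj_distribL ex_disj_distrib)
  qed
  finally show ?thesis .
qed

lemma measurable_sigma_gen: "Y \<in> measurable M N \<Longrightarrow> Y \<in> measurable (sigma_gen M N Y) N"
  unfolding sigma_gen_def by (rule measurable_vimage_algebra1) (auto dest: measurable_space)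

lemma sigma_gen_subalgebra:
  assumes "space S = space M" "Y \<in> measurable S N"
  shows "subalgebra S (sigma_gen M N Y)"
  using sets_image_in_sets[OF assms] assms(1) by (simp add: subalgebra_def sigma_gen_def)

lemma measurable_sigma_past:
  assumes "\<And>j. j \<in> {1..i} \<Longrightarrow> \<xi> j \<in> measurable M N" "j \<in> {1..i}"
  shows "\<xi> j \<in> measurable (sigma_past M N \<xi> i) N"
proof -
  let ?h = "\<lambda>\<omega>. \<lambda>j\<in>{1..i}. \<xi> j \<omega>"
  have "?h \<in> space M \<rightarrow> space (\<Pi>\<^sub>M j\<in>{1..i}. N)"
    by (auto simp: space_PiM intro!: measurable_space[OF assms(1)])
  then have "?h \<in> measurable (sigma_past M N \<xi> i) (\<Pi>\<^sub>M j\<in>{1..i}. N)"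
    unfolding sigma_past_def by (rule measurable_vimage_algebra1)
  from measurable_compose[OF this measurable_component_singleton[OF assms(2)]] show ?thesis
    using assms(2) by simp
qed

lemma sigma_past_subalgebra:
  assumes "space S = space M" "\<And>j. j \<in> {1..i} \<Longrightarrow> \<xi> j \<in> measurable S N"
  shows "subalgebra S (sigma_past M N \<xi> i)"
proof -
  have "(\<lambda>\<omega>. \<lambda>j\<in>{1..i}. \<xi> j \<omega>) \<in> measurable S (\<Pi>\<^sub>M j\<in>{1..i}. N)"
    using assms(2) by (intro measurable_restrict)
  then show ?thesis
    using sets_image_in_sets[OF assms(1)] assms(1) by (simp add: subalgebra_def sigma_past_def)
qed


lemma (in prob_space) AE_cond_exp_const:
  fixes f :: "'a \<Rightarrow> real"
  assumes "subalgebra M A" "\<And>x. x \<in> space M \<Longrightarrow> f x = c" "f \<in> borel_measurable M"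
  shows "AE x in M. real_cond_exp M A f x = c"
proof -
  interpret A: sigma_finite_subalgebra M A by (rule sigma_finite_subalg) fact
  have "AE x in M. real_cond_exp M A f x = real_cond_exp M A (\<lambda>_. c) x"
    using assms(2,3) by (intro A.real_cond_exp_cong AE_I2) auto
  moreover have "AE x in M. real_cond_exp M A (\<lambda>_. c) x = c"
    by (intro A.real_cond_exp_F_meas) auto
  ultimately show ?thesis
    by eventually_elim simp
qed

section \<open>A Markov chain as a mixing filtration\<close>

locale correlated_markov_chain = prob_space M
  for M :: "'a measure" +
  fixes N :: "'b measure" and n :: nat and \<xi> :: "nat \<Rightarrow> 'a \<Rightarrow> 'b"
  assumes chain: "markov_chain M N n \<xi>"
    and n_pos: "1 \<le> n"
    and lambda_pos: "0 < chain_lambda M N n \<xi>"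
begin

text \<open>Cutting at \<open>n\<close> keeps the filtration constant after the end of the
  chain.\<close>

definition past :: "nat \<Rightarrow> 'a measure" where
  "past k = sigma_past M N \<xi> (min k n)"

text \<open>Outside \<open>{1..n}\<close> the present is trivial, so time \<open>0\<close> and all
  times after \<open>n\<close> satisfy the locale axioms.\<close>

definition present :: "nat \<Rightarrow> 'a measure" where
  "present k = (if k \<in> {1..n} then sigma_gen M N (\<xi> k) else sigma_past M N \<xi> 0)"

lemma measurable_xi: "j \<in> {1..n} \<Longrightarrow> \<xi> j \<in> measurable M N"
  using chain by (simp add: markov_chain_def)

lemma measurable_xi_past:
  assumes "j \<in> {1..min k n}"
  shows "\<xi> j \<in> measurable (past k) N"
  unfolding past_def using assms by (intro measurable_sigma_past measurable_xi) auto

lemma space_past [simp]: "space (past k) = space M"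
  by (simp add: past_def)

lemma space_present [simp]: "space (present k) = space M"
  by (simp add: present_def)

lemma subalgebra_past: "subalgebra M (past k)"
  unfolding past_def by (intro sigma_past_subalgebra measurable_xi) auto

lemma subalgebra_past_present: "subalgebra (past k) (present k)"
proof (cases "k \<in> {1..n}")
  case True
  then show ?thesis
    by (auto simp: present_def intro!: sigma_gen_subalgebra measurable_xi_past)
next
  case False
  then have "present k = sigma_past M N \<xi> 0"
    by (auto simp: present_def)
  then show ?thesis
    by (auto intro!: sigma_past_subalgebra)
qed

lemma subalgebra_present: "subalgebra M (present k)"
  using subalgebra_past[of k] subalgebra_past_present[of k] by (auto simp: subalgebra_def)

lemma subalgebra_past_Suc: "subalgebra (past (Suc k)) (past k)"
  unfolding past_def[of k] by (intro sigma_past_subalgebra measurable_xi_past) auto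

lemma present_trivial: "k \<notin> {1..n} \<Longrightarrow> sets (present k) = {{}, space M}"
  using sets_sigma_past_0[of M N \<xi>] by (auto simp: present_def)

text \<open>Inside the chain, \<open>cond_exp_markov_extend\<close> carries the definition from
  indicators to bounded functions. At \<open>k = 0\<close> past and present coincide; from
  \<open>n\<close> on, \<open>f\<close> is constant.\<close>

lemma markov_present:
  assumes f: "f \<in> borel_measurable (present (Suc k))" "ess_bounded f"
  shows "AE x in M. real_cond_exp M (past k) f x = real_cond_exp M (present k) f x"
proof -
  consider "k = 0" | "1 \<le> k" "k < n" | "n \<le> k" by linarith
  then show ?thesis
  proof cases
    case 1
    then show ?thesis by (simp add: past_def present_def)
  next
    case 3
    then have "sets (present (Suc k)) = {{}, space (present (Suc k))}"
      using present_trivial[of "Suc k"] by simp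
    with f(1) obtain c where "\<And>x. x \<in> space M \<Longrightarrow> f x = c"
      by (rule measurable_trivial_const) auto
    then have "AE x in M. real_cond_exp M (past k) f x = c" "AE x in M. real_cond_exp M (present k) f x = c"
      using f(2) by (auto intro!: AE_cond_exp_const subalgebra_past subalgebra_present
          simp: ess_bounded_measurable)
    then show ?thesis by eventually_elim simp
  next
    case 2
    then have past: "past k = sigma_past M N \<xi> k" and present: "present k = sigma_gen M N (\<xi> k)"
      and Suc: "present (Suc k) = sigma_gen M N (\<xi> (Suc k))"
      by (auto simp: past_def present_def)
    have xi: "\<xi> (Suc k) \<in> measurable M N"
      using 2 by (intro measurable_xi) auto
    show ?thesis
    proof (rule cond_exp_markov_extend[OF subalgebra_past subalgebra_past_present subalgebra_present _ f])
      fix A assume "A \<in> sets (present (Suc k))"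
      then obtain B where B: "B \<in> sets N" "A = \<xi> (Suc k) -` B \<inter> space M"
        unfolding Suc sigma_gen_def
        using sets_vimage_algebra2[of "\<xi> (Suc k)" "space M" N] measurable_space[OF xi] by auto
      let ?b = "\<lambda>\<omega>. indicator B (\<xi> (Suc k) \<omega>) :: real"
      have A: "A \<in> sets M"
        unfolding B(2) using measurable_sets[OF xi B(1)] .
      have b: "?b \<in> borel_measurable M"
        using xi B(1) by measurable
      have eq: "AE x in M. real_cond_exp M S (indicator A) x = real_cond_exp M S ?b x"
        if "subalgebra M S" for S
      proof -
        interpret S: sigma_finite_subalgebra M S by (rule sigma_finite_subalg) fact
        show ?thesis
          using A b by (intro S.real_cond_exp_cong AE_I2) (auto simp: B(2) indicator_def)
      qed
      have "AE x in M. real_cond_exp M (past k) ?b x = real_cond_exp M (present k) ?b x"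
        using chain 2 B(1) unfolding past present markov_chain_def by auto
      then show "AE x in M. real_cond_exp M (past k) (indicator A) x = real_cond_exp M (present k) (indicator A) x"
        using eq[OF subalgebra_past[of k]] eq[OF subalgebra_present[of k]] by eventually_elim simp
    qed
  qed
qed

lemma chain_rho_ge:
  assumes "1 \<le> k" "k < n"
  shows "max_corr M (present k) (present (Suc k)) \<le> chain_rho M N n \<xi>"
proof -
  have "max_corr M (sigma_gen M N (\<xi> k)) (sigma_gen M N (\<xi> (Suc k)))
      \<le> (MAX s\<in>{1..n - 1}. max_corr M (sigma_gen M N (\<xi> s)) (sigma_gen M N (\<xi> (Suc s))))"
    using assms by (intro Max_ge) auto
  then show ?thesis
    using assms by (simp add: chain_rho_def present_def)
qed

lemma lambda_le_1: "chain_lambda M N n \<xi> \<le> 1"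
proof (cases "n \<le> 1")
  case True
  then show ?thesis by (simp add: chain_lambda_def chain_rho_def)
next
  case False
  have "0 \<le> max_corr M (present 1) (present (Suc 1))"
    by (intro max_corr_nonneg subalgebra_present)
  also have "\<dots> \<le> chain_rho M N n \<xi>"
    using False by (intro chain_rho_ge) auto
  finally show ?thesis by (simp add: chain_lambda_def)
qed

text \<open>At both ends one of the two sigma-algebras is trivial, and the projection of a mean zero
  function vanishes; in between this is the duality bound.\<close>

lemma contraction_present:
  assumes f: "f \<in> borel_measurable (present (Suc k))" "ess_bounded f" "expectation f = 0"
  shows "expectation (\<lambda>x. (real_cond_exp M (present k) f x)\<^sup>2)
    \<le> (1 - chain_lambda M N n \<xi>)\<^sup>2 * expectation (\<lambda>x. (f x)\<^sup>2)"
proof -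
  let ?g = "real_cond_exp M (present k) f"
  have g: "ess_bounded ?g"
    by (rule ess_bounded_cond_exp[OF subalgebra_present f(2)])
  have trivial: ?thesis if "AE x in M. ?g x = 0"
  proof -
    have "expectation (\<lambda>x. (?g x)\<^sup>2) = expectation (\<lambda>_. 0)"
      using that g by (intro integral_cong_AE) (auto simp: ess_bounded_measurable)
    then show ?thesis by simp
  qed
  consider "k = 0" | "1 \<le> k" "k < n" | "n \<le> k" by linarith
  then show ?thesis
  proof cases
    case 1
    have "sets (present k) = {{}, space (present k)}"
      using present_trivial[of k] 1 by simp
    moreover have "?g \<in> borel_measurable (present k)"
      by simp
    ultimately obtain c where c: "\<And>x. x \<in> space M \<Longrightarrow> ?g x = c"
      using measurable_trivial_const[of ?g "present k"] by auto
    have "c = expectation (\<lambda>_. c)"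
      by (simp add: prob_space)
    also have "\<dots> = expectation ?g"
      using c by (intro Bochner_Integration.integral_cong) auto
    also have "\<dots> = 0"
      using expectation_cond_exp_mult[OF subalgebra_present f(2), of "\<lambda>_. 1" k] f(3) by simp
    finally show ?thesis
      using c by (intro trivial AE_I2) simp
  next
    case 3
    then have "sets (present (Suc k)) = {{}, space (present (Suc k))}"
      using present_trivial[of "Suc k"] by simp
    with f(1) obtain c where c: "\<And>x. x \<in> space M \<Longrightarrow> f x = c"
      by (rule measurable_trivial_const) auto
    have "expectation f = expectation (\<lambda>_. c)"
      using c by (intro Bochner_Integration.integral_cong) auto
    then have "c = 0"
      using f(3) by (simp add: prob_space)
    then show ?thesis
      using c f(2) by (intro trivial AE_cond_exp_const subalgebra_present) (auto simp: ess_bounded_measurable)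
  next
    case 2
    have "expectation (\<lambda>x. (?g x)\<^sup>2)
        \<le> (max_corr M (present k) (present (Suc k)))\<^sup>2 * expectation (\<lambda>x. (f x)\<^sup>2)"
      by (intro cond_exp_square_le_max_corr subalgebra_present f)
    also have "\<dots> \<le> (1 - chain_lambda M N n \<xi>)\<^sup>2 * expectation (\<lambda>x. (f x)\<^sup>2)"
      using chain_rho_ge[OF 2] max_corr_nonneg[OF subalgebra_present subalgebra_present]
      by (intro mult_right_mono power_mono) (auto simp: chain_lambda_def)
    finally show ?thesis .
  qed
qed

sublocale mixing_filtration M past present "chain_lambda M N n \<xi>"
proof
  show "sets (past 0) = {{}, space M}"
    by (simp add: past_def sets_sigma_past_0)
qed (use subalgebra_past subalgebra_past_present subalgebra_past_Suc markov_present
    contraction_present lambda_pos lambda_le_1 in auto)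

end

subsection \<open>The central limit theorem\<close>

context mixing_filtration
begin

text \<open>\<open>exp (- x) \<le> 1 / (1 + x) \<le> 1 - x / 2\<close> at \<open>x = lam / 2\<close>
  gives \<open>1 - q \<ge> lam / 4\<close>.\<close>

lemma Theta_le: "\<Theta> \<le> 4 / lam"
proof -
  define x where "x = lam / 2"
  have x: "0 < x" "x \<le> 1 / 2"
    using lam_pos lam_le by (auto simp: x_def)
  have "exp (- x) \<le> 1 / (1 + x)"
    using exp_ge_add_one_self[of x] x by (simp add: exp_minus field_simps)
  also have "\<dots> \<le> 1 - x / 2"
  proof -
    have "x * x \<le> x * 1"
      using x by (intro mult_left_mono) auto
    then have "1 \<le> (1 - x / 2) * (1 + x)"
      by (simp add: algebra_simps)
    then show ?thesis
      using x by (simp add: pos_divide_le_eq)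
  qed
  finally have "lam / 4 \<le> 1 - q"
    by (simp add: q_def x_def)
  then show ?thesis
    using lam_pos by (simp add: \<Theta>_def field_simps)
qed

text \<open>Origin of the logarithm: \<open>q ^ K \<le> exp (- 10) * lam ^ 5\<close>, where four
  powers of \<open>lam\<close> compensate \<open>\<Theta> ^ 4\<close> and the fifth the denominator
  from \<open>bsq_le\<close>. The factor \<open>exp (- 10)\<close> absorbs
  \<open>4 ^ 5\<close>.\<close>

lemma Theta_q_power_le:
  assumes "20 * (1 + \<bar>ln lam\<bar>) / lam \<le> real K" "0 \<le> v"
  shows "\<Theta> ^ 4 * q ^ K * (4 * v / lam) \<le> 8 * v"
proof -
  have "20 * (1 + \<bar>ln lam\<bar>) \<le> real K * lam"
    using assms(1) lam_pos by (simp add: pos_divide_le_eq)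
  then have "q ^ K \<le> exp (- (10 * (1 + \<bar>ln lam\<bar>)))"
    by (simp add: q_def flip: exp_of_nat_mult)
  also have "\<dots> \<le> exp (- 10) * exp (5 * ln lam)"
    using lam_le lam_pos by (simp flip: exp_add)
  also have "\<dots> \<le> 1 / 1024 * lam ^ 5"
  proof (rule mult_mono)
    have "2 ^ 10 \<le> exp (1 :: real) ^ 10"
      using exp_ge_add_one_self[of 1] by (intro power_mono) auto
    then show "exp (- 10) \<le> 1 / (1024 :: real)"
      by (simp add: exp_minus field_simps flip: exp_of_nat_mult)
    show "exp (5 * ln lam) \<le> lam ^ 5"
      using exp_of_nat_mult[of 5 "ln lam"] lam_pos by simp
  qed auto
  finally have q: "q ^ K \<le> 1 / 1024 * lam ^ 5" .
  have "\<Theta> ^ 4 * q ^ K \<le> (4 / lam) ^ 4 * (1 / 1024 * lam ^ 5)"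
    using Theta_le Theta_ge lam_pos q q_pos by (intro mult_mono power_mono) auto
  also have "\<dots> = lam / 4"
    using lam_pos by (simp add: power_divide eval_nat_numeral)
  finally have "\<Theta> ^ 4 * q ^ K * (4 * v / lam) \<le> lam / 4 * (4 * v / lam)"
    using \<open>0 \<le> v\<close> lam_pos by (intro mult_right_mono) auto
  then show ?thesis
    using \<open>0 \<le> v\<close> lam_pos by simp
qed

end

context correlated_markov_chain
begin

lemma char_row_sum_approx:
  fixes f :: "nat \<Rightarrow> 'b \<Rightarrow> real" and X :: "nat \<Rightarrow> 'a \<Rightarrow> real" and C t :: real
  assumes f: "\<And>i. i \<in> {1..n} \<Longrightarrow> f i \<in> borel_measurable N"
    and X: "\<And>i. i \<in> {1..n} \<Longrightarrow> X i = (\<lambda>\<omega>. f i (\<xi> i \<omega>))"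
    and mean: "\<And>i. i \<in> {1..n} \<Longrightarrow> expectation (X i) = 0"
    and bound: "\<And>i. i \<in> {1..n} \<Longrightarrow> AE \<omega> in M. \<bar>X i \<omega>\<bar> \<le> C" and "0 < C"
    and b_pos: "0 < b_sum M n X"
  defines "\<eta> \<equiv> 21 * (C * (1 + \<bar>ln (chain_lambda M N n \<xi>)\<bar>) / (chain_lambda M N n \<xi> * sigma_sum M n X))"
  shows "cmod (char (distr M borel (\<lambda>\<omega>. row_sum n X \<omega> / sigma_sum M n X)) t - exp (- t\<^sup>2 / 2))
    \<le> 6000 * \<bar>t\<bar> ^ 3 * \<eta> + 2500 * t ^ 4 * \<eta>\<^sup>2"
proof -
  let ?l = "chain_lambda M N n \<xi>"
  \<comment> \<open>The locales speak about all indices, so the row is continued by zero.\<close>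
  define Y where "Y i = (if i \<in> {1..n} then X i else (\<lambda>_. 0))" for i
  have YX: "Y i = X i" if "i \<in> {1..n}" for i
    unfolding Y_def using that by (rule if_P)
  have Y_meas: "Y i \<in> borel_measurable (present i)" for i
  proof (cases "i \<in> {1..n}")
    case True
    have "\<xi> i \<in> measurable (present i) N"
      using True measurable_sigma_gen[OF measurable_xi[OF True]] by (simp add: present_def)
    then show ?thesis
      unfolding YX[OF True] X[OF True] using f[OF True] by (rule measurable_compose)
  next
    case False
    then have "Y i = (\<lambda>_. 0)"
      unfolding Y_def by (rule if_not_P)
    then show ?thesis by simp
  qed
  have Y_bound: "AE x in M. \<bar>Y i x\<bar> \<le> C" for i
    using bound[of i] \<open>0 < C\<close> by (auto simp: Y_def)
  interpret mixing_chain M past present ?l n Y C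
  proof
    fix j
    show "Y j \<in> borel_measurable (present j)" by (rule Y_meas)
    show "ess_bounded (Y j)"
      using Y_bound measurable_from_subalg[OF subalgebra_present Y_meas] by (rule ess_boundedI[rotated])
    show "expectation (Y j) = 0"
      using mean[of j] by (cases "j \<in> {1..n}") (auto simp: Y_def)
  qed (use Y_bound \<open>0 < C\<close> in auto)
  define K where "K = nat \<lceil>20 * (1 + \<bar>ln ?l\<bar>) / ?l\<rceil>"
  have ratio_ge: "1 / ?l \<le> (1 + \<bar>ln ?l\<bar>) / ?l"
    using lambda_pos by (intro divide_right_mono) auto
  have K_ge: "20 * (1 + \<bar>ln ?l\<bar>) / ?l \<le> real K"
    unfolding K_def by (rule real_nat_ceiling_ge)
  have "0 \<le> 20 * (1 + \<bar>ln ?l\<bar>) / ?l"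
    using lambda_pos by (intro divide_nonneg_pos) auto
  then have "0 \<le> \<lceil>20 * (1 + \<bar>ln ?l\<bar>) / ?l\<rceil>"
    unfolding zero_le_ceiling by linarith
  then have "real K = of_int \<lceil>20 * (1 + \<bar>ln ?l\<bar>) / ?l\<rceil>"
    unfolding K_def by (rule of_nat_nat)
  also have "\<dots> \<le> 20 * (1 + \<bar>ln ?l\<bar>) / ?l + 1"
    by (rule of_int_ceiling_le_add_one)
  finally have "real K \<le> 20 * (1 + \<bar>ln ?l\<bar>) / ?l + 1" .
  \<comment> \<open>Rounding up adds at most one, hence at most this ratio: \<open>20\<close>
    becomes the \<open>21\<close> in \<open>\<eta>\<close>.\<close>
  moreover have "1 \<le> (1 + \<bar>ln ?l\<bar>) / ?l"
    unfolding pos_le_divide_eq[OF lambda_pos] using lambda_le_1 by linarith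
  ultimately have K_le: "real K \<le> 21 * ((1 + \<bar>ln ?l\<bar>) / ?l)"
    by linarith
  interpret mixing_chain_window M past present ?l n Y C K
  proof
    show "\<Theta> \<le> real K"
    proof -
      have "4 / ?l = 4 * (1 / ?l)" "0 \<le> 1 / ?l"
        using lambda_pos by auto
      moreover have "20 * ((1 + \<bar>ln ?l\<bar>) / ?l) \<le> real K"
        using K_ge by simp
      ultimately show ?thesis
        using Theta_le ratio_ge by linarith
    qed
    have "\<Theta> ^ 4 * q ^ K * bsq \<le> \<Theta> ^ 4 * q ^ K * (4 * v / ?l)"
      using bsq_le Theta_ge q_pos by (intro mult_left_mono) auto
    also have "\<dots> \<le> 8 * v"
      by (intro Theta_q_power_le K_ge v_nonneg)
    finally show "\<Theta> ^ 4 * q ^ K * bsq \<le> 8 * v" .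
  qed
  have S: "row_sum n X x = S n x" for x
    unfolding row_sum_def S_def by (intro sum.cong) (auto simp: YX)
  then have S': "row_sum n X = S n" by auto
  have ES: "expectation (S n) = 0"
    unfolding S_def[abs_def] by (simp add: Bochner_Integration.integral_sum g_centered)
  define \<sigma> where "\<sigma> = sigma_sum M n X"
  have \<sigma>: "\<sigma> = sqrt v"
    by (simp add: \<sigma>_def sigma_sum_def S' ES v_def)
  have "b_sum M n X = sqrt bsq"
    unfolding b_sum_def bsq_def using mean by (intro arg_cong[where f = sqrt] sum.cong) (auto simp: YX)
  then have "0 < bsq"
    using b_pos by simp
  \<comment> \<open>Positivity of \<open>b_sum\<close> passes to the variance of the sum through
    \<open>bsq_le\<close>.\<close>
  then have "0 < 4 * v / ?l"
    using bsq_le by linarith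
  then have v_pos: "0 < v"
    using lambda_pos by (simp add: zero_less_divide_iff)
  then have \<sigma>_pos: "0 < \<sigma>" and v: "v = \<sigma>\<^sup>2"
    by (simp_all add: \<sigma>)
  have "char (distr M borel (\<lambda>\<omega>. row_sum n X \<omega> / \<sigma>)) t = (\<integral>x. iexp (t / \<sigma> * S n x) \<partial>M)"
    unfolding char_def S
    by (subst integral_distr) (auto simp: ess_bounded_measurable)
  moreover have "(t / \<sigma>)\<^sup>2 / 2 * v = t\<^sup>2 / 2"
    using \<sigma>_pos by (simp add: v power_divide)
  ultimately have "cmod (char (distr M borel (\<lambda>\<omega>. row_sum n X \<omega> / \<sigma>)) t - exp (- t\<^sup>2 / 2))
      \<le> 6000 * \<bar>t / \<sigma>\<bar> ^ 3 * (real K * C) * v + 2500 * (t / \<sigma>) ^ 4 * (real K * C)\<^sup>2 * v"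
    using char_S_approx[of "t / \<sigma>"] by simp
  \<comment> \<open>As \<open>v = \<sigma>\<^sup>2\<close>, one factor
    \<open>K * C / \<sigma>\<close> is left in the cubic term and two in the quartic term.\<close>
  also have "\<dots> = 6000 * \<bar>t\<bar> ^ 3 * (real K * C / \<sigma>) + 2500 * t ^ 4 * (real K * C / \<sigma>)\<^sup>2"
    using \<sigma>_pos by (simp add: v power_divide power2_eq_square power3_eq_cube power4_eq_xxxx field_simps)
  also have "\<dots> \<le> 6000 * \<bar>t\<bar> ^ 3 * \<eta> + 2500 * t ^ 4 * \<eta>\<^sup>2"
  proof -
    have "real K * C / \<sigma> \<le> 21 * ((1 + \<bar>ln ?l\<bar>) / ?l) * C / \<sigma>"
      using K_le \<open>0 < C\<close> \<sigma>_pos by (intro divide_right_mono mult_right_mono) auto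
    also have "\<dots> = \<eta>"
      by (simp add: \<eta>_def \<sigma>_def mult_ac)
    finally have "real K * C / \<sigma> \<le> \<eta>" .
    then show ?thesis
      using \<open>0 < C\<close> \<sigma>_pos by (intro add_mono mult_left_mono power_mono) auto
  qed
  finally show ?thesis
    by (simp add: \<sigma>_def)
qed

end

text \<open>By Levy's continuity theorem, pointwise convergence of the characteristic functions
  suffices; \<open>char_row_sum_approx\<close> bounds the error at each \<open>t\<close> through the
  ratio assumed to vanish.\<close>

theorem theorem1:
  fixes M :: "'a measure" and N :: "'b measure"
    and \<xi> :: "nat \<Rightarrow> nat \<Rightarrow> 'a \<Rightarrow> 'b"
    and f :: "nat \<Rightarrow> nat \<Rightarrow> 'b \<Rightarrow> real"
    and X :: "nat \<Rightarrow> nat \<Rightarrow> 'a \<Rightarrow> real"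
    and C :: "nat \<Rightarrow> real"
  assumes "prob_space M"
    and "\<And>n. n \<ge> 1 \<Longrightarrow> markov_chain M N n (\<xi> n)"
    and "\<And>n i. 1 \<le> i \<Longrightarrow> i \<le> n \<Longrightarrow> f n i \<in> borel_measurable N"
    and "\<And>n i. 1 \<le> i \<Longrightarrow> i \<le> n \<Longrightarrow> X n i = (\<lambda>\<omega>. f n i (\<xi> n i \<omega>))"
    and "\<And>n i. 1 \<le> i \<Longrightarrow> i \<le> n \<Longrightarrow> prob_space.expectation M (X n i) = 0"
    and "\<And>n i. 1 \<le> i \<Longrightarrow> i \<le> n \<Longrightarrow> integrable M (\<lambda>\<omega>. (X n i \<omega>)\<^sup>2)"
    and "\<And>n. n \<ge> 1 \<Longrightarrow> chain_lambda M N n (\<xi> n) * b_sum M n (X n) > 0"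
    and "\<And>n. n \<ge> 1 \<Longrightarrow> C n > 0"
    and "\<And>n. n \<ge> 1 \<Longrightarrow> AE \<omega> in M. (MAX i\<in>{1..n}. \<bar>X n i \<omega>\<bar>) \<le> C n"
    and "(\<lambda>n. C n * (1 + \<bar>ln (chain_lambda M N n (\<xi> n))\<bar>)
              / (chain_lambda M N n (\<xi> n) * sigma_sum M n (X n))) \<longlonglongrightarrow> 0"
  shows "weak_conv_m (\<lambda>n. distr M borel (\<lambda>\<omega>. row_sum n (X n) \<omega> / sigma_sum M n (X n)))
           std_normal_distribution"
proof (rule levy_continuity)
  interpret prob_space M by fact
  have X_meas: "X n i \<in> borel_measurable M" if "1 \<le> i" "i \<le> n" for n i
  proof -
    have "\<xi> n i \<in> measurable M N"
      using assms(2)[of n] that by (simp add: markov_chain_def)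
    then show ?thesis
      unfolding assms(4)[OF that] using assms(3)[OF that] by (rule measurable_compose)
  qed
  have row_meas: "(\<lambda>\<omega>. row_sum n (X n) \<omega> / sigma_sum M n (X n)) \<in> borel_measurable M" for n
    unfolding row_sum_def by (intro borel_measurable_divide borel_measurable_sum X_meas) auto
  show "real_distribution (distr M borel (\<lambda>\<omega>. row_sum n (X n) \<omega> / sigma_sum M n (X n)))" for n
    using row_meas by (rule real_distribution_distr)
  show "real_distribution std_normal_distribution"
    by (rule real_dist_normal_dist)
  fix t :: real
  define \<eta> where "\<eta> n = 21 * (C n * (1 + \<bar>ln (chain_lambda M N n (\<xi> n))\<bar>)
              / (chain_lambda M N n (\<xi> n) * sigma_sum M n (X n)))" for n
  let ?ch = "\<lambda>n. char (distr M borel (\<lambda>\<omega>. row_sum n (X n) \<omega> / sigma_sum M n (X n))) t"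
  have bound: "cmod (?ch n - exp (- t\<^sup>2 / 2)) \<le> 6000 * \<bar>t\<bar> ^ 3 * \<eta> n + 2500 * t ^ 4 * (\<eta> n)\<^sup>2"
    if "1 \<le> n" for n
  proof -
    \<comment> \<open>This excludes that the assumed positive product has two negative
      factors.\<close>
    have "0 \<le> b_sum M n (X n)"
      unfolding b_sum_def by (intro real_sqrt_ge_zero sum_nonneg) simp
    then have lb: "0 < chain_lambda M N n (\<xi> n)" "0 < b_sum M n (X n)"
      using assms(7)[OF that] by (auto simp: zero_less_mult_iff)
    interpret correlated_markov_chain M N n "\<xi> n"
      using assms(2)[OF that] that lb(1) by unfold_locales
    have "AE \<omega> in M. \<bar>X n i \<omega>\<bar> \<le> C n" if i: "i \<in> {1..n}" for i
      using assms(9)[OF \<open>1 \<le> n\<close>]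
    proof eventually_elim
      case (elim \<omega>)
      have "\<bar>X n i \<omega>\<bar> \<le> (MAX i\<in>{1..n}. \<bar>X n i \<omega>\<bar>)"
        using i by (intro Max_ge) auto
      with elim show ?case by linarith
    qed
    then show ?thesis
      unfolding \<eta>_def using assms(3-5,8) that lb(2)
      by (intro char_row_sum_approx[where f = "f n"]) auto
  qed
  have "\<eta> \<longlonglongrightarrow> 0"
    unfolding \<eta>_def using tendsto_mult_left[OF assms(10), of 21] by simp
  then have "(\<lambda>n. 6000 * \<bar>t\<bar> ^ 3 * \<eta> n + 2500 * t ^ 4 * (\<eta> n)\<^sup>2) \<longlonglongrightarrow> 6000 * \<bar>t\<bar> ^ 3 * 0 + 2500 * t ^ 4 * 0\<^sup>2"
    by (intro tendsto_intros)
  then have lim: "(\<lambda>n. 6000 * \<bar>t\<bar> ^ 3 * \<eta> n + 2500 * t ^ 4 * (\<eta> n)\<^sup>2) \<longlonglongrightarrow> 0"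
    by simp
  have "(\<lambda>n. ?ch n - exp (- t\<^sup>2 / 2)) \<longlonglongrightarrow> 0"
  proof (rule Lim_null_comparison[OF _ lim])
    show "\<forall>\<^sub>F n in sequentially. cmod (?ch n - exp (- t\<^sup>2 / 2))
        \<le> 6000 * \<bar>t\<bar> ^ 3 * \<eta> n + 2500 * t ^ 4 * (\<eta> n)\<^sup>2"
      using eventually_ge_at_top[of 1] by eventually_elim (rule bound)
  qed
  then show "?ch \<longlonglongrightarrow> char std_normal_distribution t"
    by (simp add: char_std_normal_distribution LIM_zero_cancel)
qed

end
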